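(* For every prime $p$ the following supercongruences hold (congruences are understood in the ring of rational numbers whose denominators are not divisible by $p$): \begin{align*} \sum_{n=0}^{(p-1)/2}\frac{(\frac12)_n^3}{n!^3}(3n+1)2^{2n} &\equiv p\pmod{p^3} \quad\text{for $p>2$},\\ \sum_{n=0}^{(p-1)/2}\frac{(\frac12)_n^5}{n!^5}(10n^2+6n+1)(-1)^n2^{2n} &\equiv p^2\pmod{p^5} \quad\text{for $p>3$},\\ \sum_{n=0}^{p-1}\frac{(\frac12)_n^3}{(1)_n^3}(3n+1)(-1)^n2^{3n} &\equiv(-1)^{(p-1)/2}p\pmod{p^3} \quad\text{for $p>2$}. \end{align*}
   Context: $p$ denotes a prime. For a real $a$ and a nonnegative integer $n$, $(a)_n=\prod_{k=0}^{n-1}(a+k)$ is the Pochhammer symbol, with $(a)_0=1$; in particular $(1)_n=n!$. *)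

theory Defs
  imports Complex_Main "HOL-Computational_Algebra.Primes"
begin

definition rat_localization :: "nat \<Rightarrow> rat set" where
  "rat_localization p = {x. \<not> int p dvd snd (quotient_of x)}"

text \<open>Congruence of \<open>x\<close> and \<open>y\<close> modulo the ideal generated by \<open>m\<close> in the ring of
  rationals with denominator not divisible by \<open>p\<close>; both sides are required to lie in that ring.\<close>

definition rat_cong :: "nat \<Rightarrow> rat \<Rightarrow> rat \<Rightarrow> nat \<Rightarrow> bool" where
  "rat_cong p x y m \<longleftrightarrow>
     x \<in> rat_localization p \<and> y \<in> rat_localization p \<and>
     (\<exists>z\<in>rat_localization p. x - y = of_nat m * z)"

end

theory Submission imports Defs "HOL-Computational_Algebra.Polynomial" begin

text \<open>
  Write \<open>p = 2 * m + 1\<close> and put the parameter \<open>Y = y^2\<close> into the cubic sums, replacing \<open>(1/2)_n^3 / n!^3\<close> by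
  \<open>(1/2)_n (1/2+y)_n (1/2-y)_n / (n! (1+2y)_n (1-2y)_n)\<close>. A WZ pair for the shift \<open>y \<mapsto> y + 1\<close> shows that at
  \<open>y = q/2\<close>, \<open>q\<close> odd, the sum terminates and equals \<open>q\<close> (up to sign). Up to the common denominator
  the sum over \<open>n \<le> m\<close> is a polynomial in \<open>Y\<close> of degree at most \<open>m\<close>, so its value at \<open>Y = 0\<close> is the Lagrange
  combination of the \<open>m + 1\<close> values at \<open>q = 1, 3, ..., p\<close>. The summand with \<open>q = p\<close> gives the main
  term, and the other summands are divisible by \<open>p^3\<close>.

  The quintic sum is deformed with two parameters, to
  \<open>(1/2)_n (1/2+y)_n (1/2-y)_n (1/2+z)_n (1/2-z)_n / (n! (1+y+z)_n (1+y-z)_n (1-y+z)_n (1-y-z)_n)\<close>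
  with factor \<open>10n^2 + 6n + 1 - 2y^2 - 2z^2\<close>; it equals \<open>2 (y^2 - z^2)\<close> at \<open>y = q/2\<close>. The numerator polynomial has
  total degree at most \<open>2 * m + 1\<close>, so the Boolean sum of the interpolations in \<open>y^2\<close> and \<open>z^2\<close> is exact. By
  symmetry the numerator vanishes at all pairs of nodes, and what remains is one explicit sum over \<open>q\<close>.
  For \<open>q < p\<close> its summands are, modulo \<open>p^5\<close>, proportional to \<open>p^4 / q^2\<close>, and the sum of the \<open>1 / q^2\<close> is
  divisible by \<open>p\<close> when \<open>p > 3\<close>.
\<close>

section \<open>WZ pairs\<close>

definition half_sq :: "nat \<Rightarrow> rat \<Rightarrow> rat" where
  "half_sq n Y = (\<Prod>i<n. (of_nat i + 1/2)^2 - Y)"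

text \<open>The products for \<open>y\<close> and \<open>y + 1\<close> are both written through \<open>half_shift\<close>. Expressing one through the
  other would divide by \<open>n - 1/2 - y\<close>, which vanishes where the sums terminate.\<close>

definition half_shift :: "nat \<Rightarrow> rat \<Rightarrow> rat" where
  "half_shift n y = (\<Prod>i<n. (of_nat i + 1/2 + y) * (of_nat i - 1/2 - y))"

definition int_sq :: "nat \<Rightarrow> rat \<Rightarrow> rat" where
  "int_sq n Y = (\<Prod>i<n. (of_nat i + 1)^2 - 4 * Y)"

text \<open>With \<open>Y = y^2\<close>, \<open>Z = z^2\<close> and \<open>a = i + 1\<close> each
  factor is \<open>(a^2 - (y+z)^2) * (a^2 - (y-z)^2)\<close>, so this is the product of the four
  Pochhammer symbols of \<open>1+y+z\<close>, \<open>1+y-z\<close>, \<open>1-y+z\<close> and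
  \<open>1-y-z\<close>.\<close>

definition cross_sq :: "nat \<Rightarrow> rat \<Rightarrow> rat \<Rightarrow> rat" where
  "cross_sq n Y Z = (\<Prod>i<n. ((of_nat i + 1)^2 - Y - Z)^2 - 4 * Y * Z)"

definition half_coeff :: "nat \<Rightarrow> rat" where
  "half_coeff n = pochhammer (1/2) n / fact n"

lemma half_coeff_Suc: "half_coeff (Suc n) = half_coeff n * (of_nat n + 1/2) / (of_nat n + 1)"
  by (simp add: half_coeff_def pochhammer_Suc add_ac mult_ac)

lemma half_sq_Suc: "half_sq (Suc n) Y = half_sq n Y * ((of_nat n + 1/2)^2 - Y)"
  and half_shift_Suc: "half_shift (Suc n) y
    = half_shift n y * ((of_nat n + 1/2 + y) * (of_nat n - 1/2 - y))"
  and int_sq_Suc: "int_sq (Suc n) Y = int_sq n Y * ((of_nat n + 1)^2 - 4 * Y)"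
  and cross_sq_Suc: "cross_sq (Suc n) Y Z
    = cross_sq n Y Z * (((of_nat n + 1)^2 - Y - Z)^2 - 4 * Y * Z)"
  by (simp_all add: half_sq_def half_shift_def int_sq_def cross_sq_def mult_ac)

lemma half_sq_via_half_shift:
  "half_sq n (y^2) * (1/2 + y) = - half_shift n y * (of_nat n - 1/2 - y)"
proof (induction n)
  case 0 show ?case by (simp add: half_sq_def half_shift_def)
next
  case (Suc n)
  have "half_sq (Suc n) (y^2) * (1/2 + y)
      = (half_sq n (y^2) * (1/2 + y)) * ((of_nat n + 1/2)^2 - y^2)"
    by (simp add: half_sq_Suc mult_ac)
  also have "\<dots> = - half_shift (Suc n) y * (of_nat (Suc n) - 1/2 - y)"
    unfolding Suc.IH half_shift_Suc of_nat_Suc by algebra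
  finally show ?case .
qed

lemma half_sq_succ_via_half_shift:
  "half_sq n ((y + 1)^2) * (1/2 + y) = half_shift n y * (of_nat n + 1/2 + y)"
proof (induction n)
  case 0 show ?case by (simp add: half_sq_def half_shift_def)
next
  case (Suc n)
  have "half_sq (Suc n) ((y + 1)^2) * (1/2 + y)
      = (half_sq n ((y + 1)^2) * (1/2 + y)) * ((of_nat n + 1/2)^2 - (y + 1)^2)"
    by (simp add: half_sq_Suc mult_ac)
  also have "\<dots> = half_shift (Suc n) y * (of_nat (Suc n) + 1/2 + y)"
    unfolding Suc.IH half_shift_Suc of_nat_Suc by algebra
  finally show ?case .
qed

text \<open>The Pochhammer symbol of \<open>1+2y\<close> moves up by two and that of
  \<open>1-2y\<close> down by two, so only end factors change. They stay multiplied out because some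
  vanish when \<open>2*y\<close> is an integer.\<close>

lemma int_sq_shift:
  "int_sq n ((y + 1)^2) * ((y + 1) * (of_nat n - 1 - 2*y) * (of_nat n - 2*y))
   = int_sq n (y^2) * ((of_nat n + 1 + 2*y) * (of_nat n + 2 + 2*y) * y)"
proof (induction n)
  case 0 show ?case by (simp add: int_sq_def) algebra
next
  case (Suc n)
  have "int_sq (Suc n) ((y + 1)^2) * ((y + 1) * (of_nat (Suc n) - 1 - 2*y) * (of_nat (Suc n) - 2*y))
     = (int_sq n ((y + 1)^2) * ((y + 1) * (of_nat n - 1 - 2*y) * (of_nat n - 2*y)))
       * ((of_nat n + 3 + 2*y) * (of_nat n + 1 - 2*y))"
    unfolding int_sq_Suc of_nat_Suc by algebra
  also have "\<dots> = int_sq (Suc n) (y^2)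
      * ((of_nat (Suc n) + 1 + 2*y) * (of_nat (Suc n) + 2 + 2*y) * y)"
    unfolding Suc.IH int_sq_Suc of_nat_Suc by algebra
  finally show ?case .
qed

text \<open>Here each of the four Pochhammer symbols moves by one; pairing the two signs of z turns
  the end factors into squares minus \<open>Z\<close>.\<close>

lemma cross_sq_shift:
  "cross_sq n ((y + 1)^2) Z * (((1 + y)^2 - Z) * ((of_nat n - y)^2 - Z))
   = cross_sq n (y^2) Z * (((of_nat n + 1 + y)^2 - Z) * (y^2 - Z))"
proof (induction n)
  case 0 show ?case by (simp add: cross_sq_def) 
next
  case (Suc n)
  have "cross_sq (Suc n) ((y + 1)^2) Z * (((1 + y)^2 - Z) * ((of_nat (Suc n) - y)^2 - Z))
     = (cross_sq n ((y + 1)^2) Z * (((1 + y)^2 - Z) * ((of_nat n - y)^2 - Z)))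
       * (((of_nat n + 2 + y)^2 - Z) * ((of_nat n + 1 - y)^2 - Z))"
    unfolding cross_sq_Suc of_nat_Suc by algebra
  also have "\<dots> = cross_sq (Suc n) (y^2) Z
      * (((of_nat (Suc n) + 1 + y)^2 - Z) * (y^2 - Z))"
    unfolding Suc.IH cross_sq_Suc of_nat_Suc by algebra
  finally show ?case .
qed

section \<open>Deformed summands, WZ certificates and telescoping\<close>

definition cubic_term :: "rat \<Rightarrow> nat \<Rightarrow> rat \<Rightarrow> rat" where
  "cubic_term z n Y = half_coeff n * z^n * (3 * of_nat n + 1) * half_sq n Y / int_sq n Y"

definition quintic_term :: "nat \<Rightarrow> rat \<Rightarrow> rat \<Rightarrow> rat" where
  "quintic_term n Y Z = half_coeff n * (-4)^n * (10 * (of_nat n)^2 + 6 * of_nat n + 1 - 2 * Y - 2 * Z)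
     * half_sq n Y * half_sq n Z / cross_sq n Y Z"

text \<open>The common factor of the summands at \<open>y\<close> and at \<open>y + 1\<close>: both
  are rational functions of \<open>n\<close> and \<open>y\<close> times this weight, which reduces
  the WZ equation to an identity of rational functions.\<close>

definition cubic_weight :: "rat \<Rightarrow> nat \<Rightarrow> rat \<Rightarrow> rat" where
  "cubic_weight z n y = half_coeff n * z^n * half_shift n y / int_sq n (y^2)"

lemma cubic_terms_factored:
  fixes y z :: rat
  assumes y: "y > 0" and d: "int_sq n (y^2) \<noteq> 0" "int_sq n ((y+1)^2) \<noteq> 0"
  defines "x \<equiv> cubic_weight z n y"
  shows "cubic_term z n (y^2) = - x * (3 * of_nat n + 1) * (of_nat n - 1/2 - y) / (1/2 + y)"
    and "cubic_term z n ((y+1)^2) = x * (3 * of_nat n + 1) * (of_nat n + 1/2 + y) / (1/2 + y)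
      * ((y + 1) * (of_nat n - 1 - 2*y) * (of_nat n - 2*y))
      / ((of_nat n + 1 + 2*y) * (of_nat n + 2 + 2*y) * y)"
proof -
  have y2: "1/2 + y \<noteq> 0" using y by simp
  have h1: "half_sq n (y^2) = - half_shift n y * (of_nat n - 1/2 - y) / (1/2 + y)"
    using half_sq_via_half_shift[of n y] y2 nonzero_eq_divide_eq by blast
  show "cubic_term z n (y^2) = - x * (3 * of_nat n + 1) * (of_nat n - 1/2 - y) / (1/2 + y)"
    unfolding cubic_term_def x_def cubic_weight_def h1 by (simp add: mult_ac)
  have h2: "half_sq n ((y+1)^2) = half_shift n y * (of_nat n + 1/2 + y) / (1/2 + y)"
    using half_sq_succ_via_half_shift[of n y] y2 nonzero_eq_divide_eq by blast
  define Q where "Q = (y + 1) * (of_nat n - 1 - 2*y) * (of_nat n - 2*y)"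
  define R where "R = (of_nat n + 1 + 2*y) * (of_nat n + 2 + 2*y) * y"
  have R: "R \<noteq> 0" 
  proof -
    have "of_nat n + 1 + 2*y > 0" "of_nat n + 2 + 2*y > 0" using y by (simp_all add: add_nonneg_pos)
    then show ?thesis using y by (simp add: R_def)
  qed
  have h3: "1 / int_sq n ((y+1)^2) = Q / (int_sq n (y^2) * R)"
    using int_sq_shift[of n y] R d unfolding Q_def[symmetric] R_def[symmetric] 
    by (simp add: field_simps)
  have "cubic_term z n ((y+1)^2) = half_coeff n * z^n * (3 * of_nat n + 1) * half_sq n ((y+1)^2)
     * (1 / int_sq n ((y+1)^2))" by (simp add: cubic_term_def)
  also have "\<dots> = x * (3 * of_nat n + 1) * (of_nat n + 1/2 + y) / (1/2 + y) * Q / R"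
    unfolding h2 h3 x_def cubic_weight_def by (simp add: mult_ac)
  finally show "cubic_term z n ((y+1)^2) = x * (3 * of_nat n + 1) * (of_nat n + 1/2 + y) / (1/2 + y)
      * ((y + 1) * (of_nat n - 1 - 2*y) * (of_nat n - 2*y))
      / ((of_nat n + 1 + 2*y) * (of_nat n + 2 + 2*y) * y)"
    unfolding Q_def R_def .
qed

text \<open>The WZ equation, with \<open>M\<close> for \<open>n\<close> and \<open>X\<close> for the
  weight. The right side is an upper minus a lower boundary term. By \<open>cubic_boundary_4\<close>
  the upper one at \<open>n\<close> is the lower one at \<open>n + 1\<close>; the lower one contains
  \<open>M^2\<close>, so it starts at 0.\<close>

lemma cubic_certificate_4:
  fixes X M y :: rat
  assumes "y > 0" "M \<ge> 0"
  shows "(y+1) * (- X * (3*M+1) * (M-1/2-y) / (1/2+y))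
       - y * (X * (3*M+1) * (M+1/2+y) / (1/2+y) * ((y+1) * (M-1-2*y) * (M-2*y)) / ((M+1+2*y) * (M+2+2*y) * y))
     = - X * (8 * (2+2*y) * (M+1/2) * (M+1/2+y) * (M-1/2-y) * (M+1)) / ((1+2*y) * (M+1+2*y) * (M+2+2*y))
       - (- X * (M^2 * (M-2*y) * 2 * (2+2*y)) / ((1+2*y) * (M+1+2*y)))"
proof -
  have nz: "1/2+y \<noteq> 0" "M+1+2*y \<noteq> 0" "M+2+2*y \<noteq> 0" "y \<noteq> 0" "1+2*y \<noteq> 0" 
    using assms by auto
  have e: "1/2 + y = (1+2*y)/2" by (simp add: field_simps)
  \<comment> \<open>The denominators stay atomic while fractions are cleared; unfolded again, they
    leave a polynomial identity.\<close>
  define u v w where "u = 1+2*y" and "v = M+1+2*y" and "w = M+2+2*y"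
  have nz': "u \<noteq> 0" "v \<noteq> 0" "w \<noteq> 0" using nz by (auto simp: u_def v_def w_def)
  show ?thesis unfolding e u_def[symmetric] v_def[symmetric] w_def[symmetric]
    using nz' \<open>y \<noteq> 0\<close> apply (simp add: divide_simps)
    unfolding u_def v_def w_def by algebra
qed

text \<open>For this weight the two summands are added, which makes the values at consecutive nodes
  alternate in sign.\<close>

lemma cubic_certificate_8:
  fixes X M y :: rat
  assumes "y > 0" "M \<ge> 0"
  shows "(y+1) * (- X * (3*M+1) * (M-1/2-y) / (1/2+y))
       + y * (X * (3*M+1) * (M+1/2+y) / (1/2+y) * ((y+1) * (M-1-2*y) * (M-2*y)) / ((M+1+2*y) * (M+2+2*y) * y))
     = - X * (8 * (2+2*y) * (M+1/2) * (M+1/2+y) * (M-1/2-y)) / ((M+1+2*y) * (M+2+2*y))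
       - X * (M * (M-2*y) * (2+2*y)) / (M+1+2*y)"
proof -
  have nz: "1/2+y \<noteq> 0" "M+1+2*y \<noteq> 0" "M+2+2*y \<noteq> 0" "y \<noteq> 0" "1+2*y \<noteq> 0" 
    using assms by auto
  have e: "1/2 + y = (1+2*y)/2" by (simp add: field_simps)
  define u v w where "u = 1+2*y" and "v = M+1+2*y" and "w = M+2+2*y"
  have nz': "u \<noteq> 0" "v \<noteq> 0" "w \<noteq> 0" using nz by (auto simp: u_def v_def w_def)
  show ?thesis unfolding e u_def[symmetric] v_def[symmetric] w_def[symmetric]
    using nz' \<open>y \<noteq> 0\<close> apply (simp add: divide_simps)
    unfolding u_def v_def w_def by algebra
qed

text \<open>Only \<open>y\<close> is shifted and \<open>Z\<close> is a spectator. With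
  \<open>Z < 0\<close> every square minus \<open>Z\<close> is positive, so no denominator
  vanishes.\<close>

lemma quintic_certificate:
  fixes X M y Z :: rat
  assumes "y > 0" "M \<ge> 0" "Z < 0"
  shows "((y+1)^2-Z) * (- X * (10*M^2+6*M+1-2*y^2-2*Z) * (M-1/2-y) / (1/2+y))
       - (y^2-Z) * (X * (10*M^2+6*M+1-2*(y+1)^2-2*Z) * (M+1/2+y) / (1/2+y)
          * (((1+y)^2-Z) * ((M-y)^2-Z)) / (((M+1+y)^2-Z) * (y^2-Z)))
     = - X * (16 * ((1+y)^2-Z) * (M+1/2) * (M+1/2+y) * (M-1/2-y) * ((M+1/2)^2-Z)) / ((1/2+y) * ((M+1+y)^2-Z))
       - X * (4 * ((1+y)^2-Z) * M * ((M-y)^2-Z)) / (1/2+y)"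
proof -
  have e: "1/2 + y = (1+2*y)/2" by (simp add: field_simps)
  define u v w where "u = 1+2*y" and "v = (M+1+y)^2-Z" and "w = y^2-Z"
  have nz': "u \<noteq> 0" using assms by (auto simp: u_def)
  have "v > 0" using assms zero_le_power2[of "M+1+y"] unfolding v_def by linarith
  moreover have "w > 0" using assms zero_le_power2[of "y"] unfolding w_def by linarith
  ultimately have nz: "v \<noteq> 0" "w \<noteq> 0" by auto
  show ?thesis unfolding e u_def[symmetric] v_def[symmetric] w_def[symmetric]
    using nz' nz apply (simp add: divide_simps)
    unfolding u_def v_def w_def by algebra
qed

text \<open>In the induction on the length of the sum, the boundary term \<open>r\<close> of the
  shorter sum cancels the lower boundary of the new summand.\<close>

lemma telescope_step:
  fixes a b s s' t t' r e :: rat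
  shows "a * s - b * s' = r \<Longrightarrow> a * t - b * t' = e - r \<Longrightarrow> a * (s + t) - b * (s' + t') = e"
    and "a * s + b * s' = r \<Longrightarrow> a * t + b * t' = e - r \<Longrightarrow> a * (s + t) + b * (s' + t') = e"
  by (simp_all add: algebra_simps)

lemma cubic_weight_Suc:
  fixes y z :: rat
  assumes "int_sq (Suc n) (y^2) \<noteq> 0"
  shows "cubic_weight z (Suc n) y * ((of_nat n + 1) * ((of_nat n + 1)^2 - 4 * y^2))
       = z * cubic_weight z n y * (of_nat n + 1/2) * (of_nat n + 1/2 + y) * (of_nat n - 1/2 - y)"
proof -
  define N D where "N = (of_nat n + 1 :: rat)" and "D = (of_nat n + 1)^2 - 4 * y^2"
  have nz: "int_sq n (y^2) \<noteq> 0" "D \<noteq> 0"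
    using assms(1) by (auto simp: int_sq_Suc D_def)
  have "N > 0" by (simp add: N_def add_nonneg_pos)
  then have "N \<noteq> 0" by simp
  then show ?thesis
    unfolding cubic_weight_def half_coeff_Suc half_shift_Suc int_sq_Suc power_Suc D_def[symmetric]
    unfolding N_def[symmetric] using nz
    by (simp add: divide_simps)
qed

text \<open>As \<open>(n+1)^2 - 4*y^2\<close> is \<open>(n+1+2*y) * (n+1-2*y)\<close>, inserting the
  ratio of consecutive weights leaves only \<open>n+1+2*y\<close> to cancel.\<close>

lemma cubic_boundary_4:
  fixes X x n y :: rat
  assumes "X * ((n+1) * ((n+1)^2 - 4*y^2)) = 4 * x * (n+1/2) * (n+1/2+y) * (n-1/2-y)"
    and "n \<ge> 0" "y > 0"
  shows "- x * (8 * (2+2*y) * (n+1/2) * (n+1/2+y) * (n-1/2-y) * (n+1)) / ((1+2*y) * (n+1+2*y) * (n+2+2*y))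
    = - X * ((n+1)^2 * ((n+1)-2*y) * 2 * (2+2*y)) / ((1+2*y) * ((n+1)+1+2*y))"
proof -
  define v where "v = n+1+2*y"
  have v: "v \<noteq> 0" using assms(2,3) by (simp add: v_def)
  have *: "- x * (8 * (2+2*y) * (n+1/2) * (n+1/2+y) * (n-1/2-y) * (n+1))
     = v * (- X * ((n+1)^2 * ((n+1)-2*y) * 2 * (2+2*y)))"
    unfolding v_def using assms(1) by algebra
  show ?thesis unfolding * v_def[symmetric] using v by (simp add: add_ac)
qed

lemma cubic_boundary_8:
  fixes X x n y :: rat
  assumes "X * ((n+1) * ((n+1)^2 - 4*y^2)) = (-8) * x * (n+1/2) * (n+1/2+y) * (n-1/2-y)"
    and "n \<ge> 0" "y > 0"
  shows "- x * (8 * (2+2*y) * (n+1/2) * (n+1/2+y) * (n-1/2-y)) / ((n+1+2*y) * (n+2+2*y))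
    = X * ((n+1) * ((n+1)-2*y) * (2+2*y)) / ((n+1)+1+2*y)"
proof -
  define v where "v = n+1+2*y"
  have v: "v \<noteq> 0" using assms(2,3) by (simp add: v_def)
  have *: "- x * (8 * (2+2*y) * (n+1/2) * (n+1/2+y) * (n-1/2-y))
     = v * (X * ((n+1) * ((n+1)-2*y) * (2+2*y)))"
    unfolding v_def using assms(1) by algebra
  show ?thesis unfolding * v_def[symmetric] using v by (simp add: add_ac)
qed

lemma quintic_boundary:
  fixes X x n y Z :: rat
  assumes "X * ((n+1) * (((n+1+y)^2-Z) * ((n+1-y)^2-Z)))
      = (-4) * x * (n+1/2) * (n+1/2+y) * (n-1/2-y) * ((n+1/2)^2-Z)"
    and "(n+1+y)^2-Z \<noteq> 0"
  shows "- x * (16 * ((1+y)^2-Z) * (n+1/2) * (n+1/2+y) * (n-1/2-y) * ((n+1/2)^2-Z)) / ((1/2+y) * ((n+1+y)^2-Z))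
    = X * (4 * ((1+y)^2-Z) * (n+1) * (((n+1)-y)^2-Z)) / (1/2+y)"
proof -
  define v where "v = (n+1+y)^2-Z"
  have *: "- x * (16 * ((1+y)^2-Z) * (n+1/2) * (n+1/2+y) * (n-1/2-y) * ((n+1/2)^2-Z))
     = v * (X * (4 * ((1+y)^2-Z) * (n+1) * (((n+1)-y)^2-Z)))"
    unfolding v_def using assms(1) by algebra
  show ?thesis unfolding * v_def[symmetric] using assms(2)[folded v_def] by simp
qed

text \<open>The boundary is kept in terms of the weight at \<open>N\<close>: the denominator of the
  weight at \<open>N + 1\<close> may vanish, and in this form the factor \<open>N - 1/2 - y\<close>
  shows that the boundary is 0 at \<open>y = N - 1/2\<close>.\<close>

lemma cubic_telescope_4:
  fixes y :: rat
  assumes y: "y > 0" and "int_sq N (y^2) \<noteq> 0" "int_sq N ((y+1)^2) \<noteq> 0"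
  shows "(y+1) * (\<Sum>n\<le>N. cubic_term 4 n (y^2)) - y * (\<Sum>n\<le>N. cubic_term 4 n ((y+1)^2))
    = - cubic_weight 4 N y
      * (8 * (2+2*y) * (of_nat N+1/2) * (of_nat N+1/2+y) * (of_nat N-1/2-y) * (of_nat N+1))
      / ((1+2*y) * (of_nat N+1+2*y) * (of_nat N+2+2*y))"
  using assms(2,3)
proof (induction N)
  case 0
  \<comment> \<open>At \<open>M = 0\<close> the lower boundary is 0, so the certificate itself is
    the claim.\<close>
  show ?case
    using cubic_certificate_4[OF y, of 0 "cubic_weight 4 0 y"]
      cubic_terms_factored[OF y 0, where z="4"] by simp
next
  case (Suc N)
  have d: "int_sq N (y^2) \<noteq> 0" "int_sq N ((y+1)^2) \<noteq> 0"
    using Suc.prems by (auto simp: int_sq_Suc)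
  have M: "(of_nat (Suc N) :: rat) = of_nat N + 1" "(of_nat N + 1 :: rat) \<ge> 0" "(of_nat N :: rat) \<ge> 0"
    by simp_all
  note b = cubic_boundary_4[OF cubic_weight_Suc[OF Suc.prems(1)] M(3) y]
  show ?case
    unfolding sum.atMost_Suc
    by (rule telescope_step(1)[OF Suc.IH[OF d, unfolded b]],
        unfold cubic_terms_factored[OF y Suc.prems] M(1),
        rule cubic_certificate_4[OF y M(2)])
qed

lemma cubic_telescope_8:
  fixes y :: rat
  assumes y: "y > 0" and "int_sq N (y^2) \<noteq> 0" "int_sq N ((y+1)^2) \<noteq> 0"
  shows "(y+1) * (\<Sum>n\<le>N. cubic_term (-8) n (y^2)) + y * (\<Sum>n\<le>N. cubic_term (-8) n ((y+1)^2))
    = - cubic_weight (-8) N y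
      * (8 * (2+2*y) * (of_nat N+1/2) * (of_nat N+1/2+y) * (of_nat N-1/2-y))
      / ((of_nat N+1+2*y) * (of_nat N+2+2*y))"
  using assms(2,3)
proof (induction N)
  case 0
  show ?case
    using cubic_certificate_8[OF y, of 0 "cubic_weight (-8) 0 y"]
      cubic_terms_factored[OF y 0, where z="-8"] by simp
next
  case (Suc N)
  have d: "int_sq N (y^2) \<noteq> 0" "int_sq N ((y+1)^2) \<noteq> 0"
    using Suc.prems by (auto simp: int_sq_Suc)
  have M: "(of_nat (Suc N) :: rat) = of_nat N + 1" "(of_nat N + 1 :: rat) \<ge> 0" "(of_nat N :: rat) \<ge> 0"
    by simp_all
  note b = cubic_boundary_8[OF cubic_weight_Suc[OF Suc.prems(1)] M(3) y]
  show ?case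
    unfolding sum.atMost_Suc
    by (rule telescope_step(2)[OF Suc.IH[OF d, unfolded b]],
        unfold cubic_terms_factored[OF y Suc.prems] M(1),
        rule cubic_certificate_8[OF y M(2)])
qed

text \<open>Grouping the four linear factors by the sign of \<open>y\<close> leaves squares minus
  \<open>Z\<close>, whose positivity for \<open>Z < 0\<close> is visible although \<open>Z\<close>
  is then no rational square.\<close>

lemma cross_sq_factor:
  "((of_nat i + 1)^2 - y^2 - Z)^2 - 4 * y^2 * Z = ((of_nat i + 1 + y)^2 - Z) * ((of_nat i + 1 - y)^2 - Z)"
  for y Z :: rat
  by algebra

lemma cross_sq_pos: assumes "Z < 0" shows "cross_sq n (y^2) Z > 0"
proof -
  have "t^2 - Z > 0" for t using assms zero_le_power2[of t] by linarith
  then show ?thesis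
    unfolding cross_sq_def cross_sq_factor by (intro prod_pos ballI mult_pos_pos)
qed

definition quintic_weight :: "nat \<Rightarrow> rat \<Rightarrow> rat \<Rightarrow> rat" where
  "quintic_weight n y Z = half_coeff n * (-4)^n * half_shift n y * half_sq n Z / cross_sq n (y^2) Z"

lemma quintic_telescope:
  fixes y Z :: rat
  assumes y: "y > 0" and Z: "Z < 0"
  shows "((y+1)^2-Z) * (\<Sum>n\<le>N. quintic_term n (y^2) Z) - (y^2-Z) * (\<Sum>n\<le>N. quintic_term n ((y+1)^2) Z)
    = - quintic_weight N y Z
      * (16 * ((1+y)^2-Z) * (of_nat N+1/2) * (of_nat N+1/2+y) * (of_nat N-1/2-y) * ((of_nat N+1/2)^2-Z))
      / ((1/2+y) * ((of_nat N+1+y)^2-Z))"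
proof -
  define x where "x = (\<lambda>n. quintic_weight n y Z)"
  have e: "cross_sq n (y^2) Z \<noteq> 0" "cross_sq n ((y+1)^2) Z \<noteq> 0" for n
    using cross_sq_pos[OF Z, of n y] cross_sq_pos[OF Z, of n "y+1"] by auto
  have pos: "t^2 - Z \<noteq> 0" for t using Z zero_le_power2[of t] by linarith
  have y2: "1/2 + y \<noteq> 0" using y by simp
  have t1: "quintic_term n (y^2) Z
     = - x n * (10*(of_nat n)^2+6*of_nat n+1-2*y^2-2*Z) * (of_nat n-1/2-y) / (1/2+y)" for n
  proof -
    have "half_sq n (y^2) = - half_shift n y * (of_nat n - 1/2 - y) / (1/2 + y)"
      using half_sq_via_half_shift[of n y] y2 nonzero_eq_divide_eq by blast
    then show ?thesis unfolding quintic_term_def x_def quintic_weight_def by (simp add: mult_ac)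
  qed
  have t2: "quintic_term n ((y+1)^2) Z
     = x n * (10*(of_nat n)^2+6*of_nat n+1-2*(y+1)^2-2*Z) * (of_nat n+1/2+y) / (1/2+y)
          * (((1+y)^2-Z) * ((of_nat n-y)^2-Z)) / (((of_nat n+1+y)^2-Z) * (y^2-Z))" for n
  proof -
    have h: "half_sq n ((y+1)^2) = half_shift n y * (of_nat n + 1/2 + y) / (1/2 + y)"
      using half_sq_succ_via_half_shift[of n y] y2 nonzero_eq_divide_eq by blast
    define Q R where "Q = ((1+y)^2-Z) * ((of_nat n-y)^2-Z)" and "R = ((of_nat n+1+y)^2-Z) * (y^2-Z)"
    have "R \<noteq> 0" using pos by (simp add: R_def)
    then have h3: "1 / cross_sq n ((y+1)^2) Z = Q / (cross_sq n (y^2) Z * R)"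
      using cross_sq_shift[of n y Z] e unfolding Q_def[symmetric] R_def[symmetric]
      by (simp add: field_simps)
    have "quintic_term n ((y+1)^2) Z = half_coeff n * (-4)^n * (10*(of_nat n)^2+6*of_nat n+1-2*(y+1)^2-2*Z)
       * half_sq n ((y+1)^2) * half_sq n Z * (1 / cross_sq n ((y+1)^2) Z)"
      by (simp add: quintic_term_def)
    also have "\<dots> = x n * (10*(of_nat n)^2+6*of_nat n+1-2*(y+1)^2-2*Z) * (of_nat n+1/2+y) / (1/2+y) * Q / R"
      unfolding h h3 x_def quintic_weight_def by (simp add: mult_ac)
    finally show ?thesis unfolding Q_def R_def .
  qed
  have x_Suc: "x (Suc N) * ((of_nat N+1) * (((of_nat N+1+y)^2-Z) * ((of_nat N+1-y)^2-Z)))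
      = (-4) * x N * (of_nat N+1/2) * (of_nat N+1/2+y) * (of_nat N-1/2-y) * ((of_nat N+1/2)^2-Z)" for N
  proof -
    define S where "S = ((of_nat N+1+y)^2-Z) * ((of_nat N+1-y)^2-Z)"
    define M :: rat where "M = of_nat N + 1"
    have S: "S \<noteq> 0" using pos by (simp add: S_def)
    have "M > 0" by (simp add: M_def add_nonneg_pos)
    then have M: "M \<noteq> 0" by simp
    have c: "cross_sq (Suc N) (y^2) Z = cross_sq N (y^2) Z * S"
      unfolding cross_sq_Suc cross_sq_factor S_def ..
    show ?thesis
      unfolding x_def quintic_weight_def c half_coeff_Suc half_shift_Suc half_sq_Suc power_Suc
        S_def[symmetric]
      unfolding M_def[symmetric]
      using S M e(1)[of N] by (simp add: divide_simps)
  qed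
  show ?thesis unfolding x_def[THEN fun_cong, symmetric]
  proof (induction N)
    case 0
    show ?case using quintic_certificate[OF y _ Z, of 0 "x 0"] t1[of 0] t2[of 0] by simp
  next
    case (Suc N)
    have M: "(of_nat (Suc N) :: rat) = of_nat N + 1" "(of_nat N + 1 :: rat) \<ge> 0" by simp_all
    note b = quintic_boundary[OF x_Suc pos]
    show ?case
      unfolding sum.atMost_Suc
      by (rule telescope_step(1)[OF Suc.IH[unfolded b]],
          unfold t1 t2 M(1), rule quintic_certificate[OF y M(2) Z])
  qed
qed

section \<open>Exact evaluation at the nodes\<close>

text \<open>The value of \<open>y^2\<close> at \<open>y = q/2\<close> for the odd number
  \<open>q = 2 * k + 1\<close>.\<close>

definition node :: "nat \<Rightarrow> rat" where
  "node k = (of_nat k + 1/2)^2"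

lemma node_Suc: "node (Suc k) = ((of_nat k + 1/2) + 1)^2"
  by (simp add: node_def add_ac)

lemma half_sq_node_eq_0: "k < n \<Longrightarrow> half_sq n (node k) = 0"
  by (auto simp: half_sq_def node_def)

lemma int_sq_factor: "(of_nat i + 1)^2 - 4 * node k = of_int ((int i - 2 * int k) * (int i + 2 * int k + 2))"
  unfolding node_def by simp algebra

text \<open>By \<open>int_sq_factor\<close> the only vanishing factor is the one with
  \<open>i = 2 * k\<close>, which lies outside the range.\<close>

lemma int_sq_node_nonzero: assumes "n \<le> 2 * k" shows "int_sq n (node k) \<noteq> 0"
proof -
  have "(of_nat i + 1)^2 - 4 * node k \<noteq> 0" if "i < n" for i
  proof -
    have "(int i - 2 * int k) * (int i + 2 * int k + 2) \<noteq> 0"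
      using that assms by auto
    then show ?thesis unfolding int_sq_factor by (simp only: of_int_eq_0_iff not_False_eq_True)
  qed
  then show ?thesis by (simp add: int_sq_def)
qed

text \<open>Telescoping up to \<open>N = k + 1\<close> involves one summand beyond the natural end
  of the sum at \<open>node k\<close>; it is 0.\<close>

lemma cubic_sum_extend:
  "(\<Sum>n\<le>Suc k. cubic_term z n (node k)) = (\<Sum>n\<le>k. cubic_term z n (node k))"
  by (simp add: cubic_term_def half_sq_node_eq_0)

text \<open>Telescoping at \<open>y = k + 1/2\<close>, \<open>N = k + 1\<close> has zero boundary,
  so \<open>y + 1\<close> times the value at \<open>k\<close> is \<open>y\<close> times the value at
  \<open>k + 1\<close>, and the values are proportional to \<open>2 * k + 1\<close>.\<close>

lemma cubic_sum_4: "(\<Sum>n\<le>k. cubic_term 4 n (node k)) = 2 * of_nat k + 1"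
proof (cases "k = 0")
  case True
  then show ?thesis by (simp add: cubic_term_def half_coeff_def half_sq_def int_sq_def)
next
  case False
  \<comment> \<open>The induction starts at 1, since passing from 0 to 1 would meet the zero
    denominator \<open>int_sq 1 (node 0)\<close>.\<close>
  then have "k \<ge> 1" by simp
  then show ?thesis
  proof (induction k rule: dec_induct)
    case base
    show ?case
      by (simp add: cubic_term_def half_coeff_def half_sq_def int_sq_def node_def power2_eq_square)
  next
    case (step k)
    define y :: rat where "y = of_nat k + 1/2"
    have y: "y > 0" by (simp add: y_def add_nonneg_pos)
    have n: "node k = y^2" "node (Suc k) = (y+1)^2"
      by (simp add: node_def y_def, simp add: node_Suc y_def)
    have "int_sq (Suc k) (y^2) \<noteq> 0" "int_sq (Suc k) ((y+1)^2) \<noteq> 0"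
      using int_sq_node_nonzero[of "Suc k" k] int_sq_node_nonzero[of "Suc k" "Suc k"] step(1)
      by (simp_all add: n)
    from cubic_telescope_4[OF y this]
    have "(y+1) * (\<Sum>n\<le>k. cubic_term 4 n (node k)) = y * (\<Sum>n\<le>Suc k. cubic_term 4 n (node (Suc k)))"
      unfolding n[symmetric] cubic_sum_extend by (simp add: y_def)
    then have "y * (\<Sum>n\<le>Suc k. cubic_term 4 n (node (Suc k))) = y * (2 * of_nat (Suc k) + 1)"
      unfolding step.IH by (simp add: y_def algebra_simps)
    then show ?case using y by (metis less_irrefl mult_left_cancel)
  qed
qed

lemma cubic_sum_8: "(\<Sum>n\<le>k. cubic_term (-8) n (node k)) = (-1)^k * (2 * of_nat k + 1)"
proof (cases "k = 0")
  case True
  then show ?thesis by (simp add: cubic_term_def half_coeff_def half_sq_def int_sq_def)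
next
  case False
  then have "k \<ge> 1" by simp
  then show ?thesis
  proof (induction k rule: dec_induct)
    case base
    show ?case
      by (simp add: cubic_term_def half_coeff_def half_sq_def int_sq_def node_def power2_eq_square)
  next
    case (step k)
    define y :: rat where "y = of_nat k + 1/2"
    have y: "y > 0" by (simp add: y_def add_nonneg_pos)
    have n: "node k = y^2" "node (Suc k) = (y+1)^2"
      by (simp add: node_def y_def, simp add: node_Suc y_def)
    have "int_sq (Suc k) (y^2) \<noteq> 0" "int_sq (Suc k) ((y+1)^2) \<noteq> 0"
      using int_sq_node_nonzero[of "Suc k" k] int_sq_node_nonzero[of "Suc k" "Suc k"] step(1)
      by (simp_all add: n)
    from cubic_telescope_8[OF y this]
    have "(y+1) * (\<Sum>n\<le>k. cubic_term (-8) n (node k))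
        + y * (\<Sum>n\<le>Suc k. cubic_term (-8) n (node (Suc k))) = 0"
      unfolding n[symmetric] cubic_sum_extend by (simp add: y_def)
    then have "y * (\<Sum>n\<le>Suc k. cubic_term (-8) n (node (Suc k)))
        = y * ((-1)^(Suc k) * (2 * of_nat (Suc k) + 1))"
      unfolding step.IH by (simp add: y_def algebra_simps)
    then show ?case using y by (metis less_irrefl mult_left_cancel)
  qed
qed

text \<open>All denominators are positive for \<open>Z < 0\<close>, so this induction along the
  nodes can start at 0.\<close>

lemma quintic_sum:
  assumes Z: "Z < 0"
  shows "(\<Sum>n\<le>k. quintic_term n (node k) Z) = 2 * (node k - Z)"
proof (induction k)
  case 0
  show ?case by (simp add: quintic_term_def half_coeff_def half_sq_def cross_sq_def node_def power2_eq_square)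
next
  case (Suc k)
  define y :: rat where "y = of_nat k + 1/2"
  have y: "y > 0" by (simp add: y_def add_nonneg_pos)
  have n: "node k = y^2" "node (Suc k) = (y+1)^2"
    by (simp add: node_def y_def, simp add: node_Suc y_def)
  have e: "(\<Sum>n\<le>Suc k. quintic_term n (node k) Z) = (\<Sum>n\<le>k. quintic_term n (node k) Z)"
    by (simp add: quintic_term_def half_sq_node_eq_0)
  have nz: "node k - Z > 0" using Z zero_le_power2[of y] unfolding n by linarith
  from quintic_telescope[OF y Z, of "Suc k"]
  have "(node (Suc k) - Z) * (\<Sum>n\<le>k. quintic_term n (node k) Z)
      = (node k - Z) * (\<Sum>n\<le>Suc k. quintic_term n (node (Suc k)) Z)"
    unfolding n[symmetric] e by (simp add: y_def)
  then have "(node k - Z) * (\<Sum>n\<le>Suc k. quintic_term n (node (Suc k)) Z)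
      = (node k - Z) * (2 * (node (Suc k) - Z))"
    unfolding Suc.IH by algebra
  then show ?case using nz by (metis less_irrefl mult_left_cancel)
qed

section \<open>Numerators over the common denominators\<close>

definition cubic_num :: "rat \<Rightarrow> nat \<Rightarrow> rat \<Rightarrow> rat" where
  "cubic_num z m Y = (\<Sum>n\<le>m. half_coeff n * z^n * (3 * of_nat n + 1) * half_sq n Y
      * (\<Prod>i=n..<m. (of_nat i + 1)^2 - 4 * Y))"

definition quintic_num :: "nat \<Rightarrow> rat \<Rightarrow> rat \<Rightarrow> rat" where
  "quintic_num m Y Z = (\<Sum>n\<le>m. half_coeff n * (-4)^n
      * (10 * (of_nat n)^2 + 6 * of_nat n + 1 - 2 * Y - 2 * Z) * half_sq n Y * half_sq n Z
      * (\<Prod>i=n..<m. ((of_nat i + 1)^2 - Y - Z)^2 - 4 * Y * Z))"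

lemma int_sq_split: "n \<le> m \<Longrightarrow> int_sq m Y = int_sq n Y * (\<Prod>i=n..<m. (of_nat i + 1)^2 - 4 * Y)"
  unfolding int_sq_def lessThan_atLeast0 by (simp add: prod.atLeastLessThan_concat)

lemma cross_sq_split: "n \<le> m \<Longrightarrow>
    cross_sq m Y Z = cross_sq n Y Z * (\<Prod>i=n..<m. ((of_nat i + 1)^2 - Y - Z)^2 - 4 * Y * Z)"
  unfolding cross_sq_def lessThan_atLeast0 by (simp add: prod.atLeastLessThan_concat)

text \<open>Summands with \<open>n > k\<close> vanish, and for \<open>n \<le> k\<close> the
  denominator \<open>int_sq n (node k)\<close> is nonzero. The common denominator is a factor on the
  right because it is 0 when \<open>2 * k < m\<close>.\<close>

lemma cubic_num_node:
  assumes "k \<le> m"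
  shows "cubic_num z m (node k) = (\<Sum>n\<le>k. cubic_term z n (node k)) * int_sq m (node k)"
proof -
  have "cubic_num z m (node k) = (\<Sum>n\<le>k. half_coeff n * z^n * (3 * of_nat n + 1) * half_sq n (node k)
      * (\<Prod>i=n..<m. (of_nat i + 1)^2 - 4 * node k))"
    unfolding cubic_num_def using assms
    by (intro sum.mono_neutral_right) (auto simp: half_sq_node_eq_0 not_le)
  also have "\<dots> = (\<Sum>n\<le>k. cubic_term z n (node k) * int_sq m (node k))"
  proof (rule sum.cong[OF refl])
    fix n assume "n \<in> {..k}"
    then show "half_coeff n * z^n * (3 * of_nat n + 1) * half_sq n (node k)
      * (\<Prod>i=n..<m. (of_nat i + 1)^2 - 4 * node k) = cubic_term z n (node k) * int_sq m (node k)"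
      using int_sq_node_nonzero[of n k] int_sq_split[of n m "node k"] assms
      by (simp add: cubic_term_def)
  qed
  finally show ?thesis by (simp add: sum_distrib_right)
qed

lemma quintic_num_node_neg:
  assumes "k \<le> m" "Z < 0"
  shows "quintic_num m (node k) Z = 2 * (node k - Z) * cross_sq m (node k) Z"
proof -
  have "quintic_num m (node k) Z = (\<Sum>n\<le>k. half_coeff n * (-4)^n
      * (10 * (of_nat n)^2 + 6 * of_nat n + 1 - 2 * node k - 2 * Z) * half_sq n (node k) * half_sq n Z
      * (\<Prod>i=n..<m. ((of_nat i + 1)^2 - node k - Z)^2 - 4 * node k * Z))"
    unfolding quintic_num_def using assms(1)
    by (intro sum.mono_neutral_right) (auto simp: half_sq_node_eq_0 not_le)
  also have "\<dots> = (\<Sum>n\<le>k. quintic_term n (node k) Z * cross_sq m (node k) Z)"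
  proof (rule sum.cong[OF refl])
    fix n assume n: "n \<in> {..k}"
    have "cross_sq n (node k) Z \<noteq> 0"
      using cross_sq_pos[OF assms(2), of n "of_nat k + 1/2"] by (simp add: node_def)
    then show "half_coeff n * (-4)^n
      * (10 * (of_nat n)^2 + 6 * of_nat n + 1 - 2 * node k - 2 * Z) * half_sq n (node k) * half_sq n Z
      * (\<Prod>i=n..<m. ((of_nat i + 1)^2 - node k - Z)^2 - 4 * node k * Z)
      = quintic_term n (node k) Z * cross_sq m (node k) Z"
      using cross_sq_split[of n m "node k" Z] assms(1) n
      by (simp add: quintic_term_def)
  qed
  also have "\<dots> = 2 * (node k - Z) * cross_sq m (node k) Z"
    by (simp only: quintic_sum[OF assms(2)] flip: sum_distrib_right)
  finally show ?thesis .
qed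

section \<open>Interpolation at zero\<close>

text \<open>The value at 0 of the Lagrange basis polynomial belonging to
  \<open>node k\<close>.\<close>

definition lagrange_weight :: "nat \<Rightarrow> nat \<Rightarrow> rat" where
  "lagrange_weight m k = (\<Prod>i\<in>{..m} - {k}. node i / (node i - node k))"

lemma node_inj: "node i = node k \<longleftrightarrow> i = k"
proof -
  have "(of_nat i + 1/2 :: rat) \<ge> 0" "(of_nat k + 1/2 :: rat) \<ge> 0" by simp_all
  then show ?thesis unfolding node_def using power2_eq_iff_nonneg by fastforce
qed

lemma lagrange_at_zero:
  fixes q :: "rat poly"
  assumes "degree q \<le> m"
  shows "poly q 0 = (\<Sum>k\<le>m. lagrange_weight m k * poly q (node k))"
proof -
  define b where "b = (\<lambda>k. \<Prod>i\<in>{..m} - {k}. smult (1 / (node k - node i)) [:- node i, 1:])"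
  define r where "r = (\<Sum>k\<le>m. smult (poly q (node k)) (b k))"
  have degb: "degree (b k) \<le> m" if "k \<le> m" for k
  proof -
    have "degree (b k) \<le> (\<Sum>i\<in>{..m} - {k}. degree (smult (1 / (node k - node i)) [:- node i, 1:]))"
      unfolding b_def by (rule degree_prod_sum_le[unfolded o_def]) simp
    also have "\<dots> \<le> (\<Sum>i\<in>{..m} - {k}. 1)" by (intro sum_mono) simp
    also have "\<dots> = m" using that by simp
    finally show ?thesis .
  qed
  have degr: "degree r \<le> m"
    unfolding r_def by (intro degree_sum_le) (auto intro: degb)
  have pb: "poly (b k) (node j) = (if j = k then 1 else 0)" if "j \<le> m" for j k
  proof (cases "j = k")
    case True
    then show ?thesis
      by (auto simp: b_def poly_prod node_inj simp flip: diff_divide_distrib intro!: prod.neutral)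
  next
    case False
    then show ?thesis using that by (auto simp: b_def poly_prod)
  qed
  have "poly r x = poly q x" if x: "x \<in> node ` {..m}" for x
  proof -
    from x obtain j where j: "j \<le> m" "x = node j" by auto
    have "poly r x = (\<Sum>k\<le>m. poly q (node k) * (if j = k then 1 else 0))"
      using j by (simp add: r_def poly_sum pb)
    also have "\<dots> = poly q x" using j by (simp add: sum.delta if_distrib cong: if_cong)
    finally show ?thesis .
  qed
  moreover have "card (node ` {..m}) = Suc m"
    by (subst card_image) (auto simp: inj_on_def node_inj)
  ultimately have "r = q" using degr assms by (intro poly_eqI_degree[of "node ` {..m}"]) auto
  then have "poly q 0 = poly r 0" by simp
  also have "\<dots> = (\<Sum>k\<le>m. poly q (node k) * poly (b k) 0)" by (simp add: r_def poly_sum)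
  also have "\<dots> = (\<Sum>k\<le>m. lagrange_weight m k * poly q (node k))"
  proof (intro sum.cong refl)
    fix k
    have "poly (b k) 0 = lagrange_weight m k"
      unfolding b_def lagrange_weight_def poly_prod
    proof (intro prod.cong refl)
      fix i assume "i \<in> {..m} - {k}"
      then have "node k - node i \<noteq> 0" "node i - node k \<noteq> 0" using node_inj[of i k] by auto
      then show "poly (smult (1 / (node k - node i)) [:- node i, 1:]) 0 = node i / (node i - node k)"
        by (simp add: divide_simps) (simp add: algebra_simps)
    qed
    then show "poly q (node k) * poly (b k) 0 = lagrange_weight m k * poly q (node k)" by simp
  qed
  finally show ?thesis .
qed

text \<open>Polynomial functions of total degree at most \<open>d\<close>, built monomial by
  monomial, so that an identity linear in the function, such as an interpolation formula, is checked
  on one monomial at a time.\<close>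

inductive bipoly :: "nat \<Rightarrow> (rat \<Rightarrow> rat \<Rightarrow> rat) \<Rightarrow> bool" for d where
  zero: "bipoly d (\<lambda>Y Z. 0)"
| add_monom: "bipoly d f \<Longrightarrow> a + b \<le> d \<Longrightarrow> bipoly d (\<lambda>Y Z. f Y Z + c * Y^a * Z^b)"

lemma bipoly_add: assumes "bipoly d f" "bipoly d g" shows "bipoly d (\<lambda>Y Z. f Y Z + g Y Z)"
  using assms(2)
proof induction
  case zero then show ?case using assms(1) by simp
next
  case (add_monom g a b c)
  from bipoly.add_monom[OF add_monom.IH add_monom.hyps(2), of c] show ?case by (simp add: add.assoc)
qed

lemma bipoly_monom: "a + b \<le> d \<Longrightarrow> bipoly d (\<lambda>Y Z. c * Y^a * Z^b)"
  using bipoly.add_monom[OF bipoly.zero] by simp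

lemma bipoly_mult_monom:
  assumes "bipoly d f" "a + b \<le> e" shows "bipoly (d + e) (\<lambda>Y Z. f Y Z * (c * Y^a * Z^b))"
  using assms(1)
proof induction
  case zero then show ?case using bipoly.zero by simp
next
  case (add_monom f a' b' c')
  have "bipoly (d + e) (\<lambda>Y Z. f Y Z * (c * Y^a * Z^b) + c' * c * Y^(a'+a) * Z^(b'+b))"
    by (rule bipoly.add_monom[OF add_monom.IH]) (use add_monom.hyps(2) assms(2) in simp)
  then show ?case by (simp add: algebra_simps power_add)
qed

lemma bipoly_mult: assumes "bipoly d f" "bipoly e g" shows "bipoly (d + e) (\<lambda>Y Z. f Y Z * g Y Z)"
  using assms(2)
proof induction
  case zero then show ?case using bipoly.zero by simp
next
  case (add_monom g a b c)
  from bipoly_add[OF add_monom.IH bipoly_mult_monom[OF assms(1) add_monom.hyps(2), of c]]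
  show ?case by (simp add: distrib_left)
qed

lemma bipoly_sum:
  "(\<And>i. i \<in> A \<Longrightarrow> bipoly d (f i)) \<Longrightarrow> bipoly d (\<lambda>Y Z. \<Sum>i\<in>A. f i Y Z)"
  by (induction A rule: infinite_finite_induct) (auto intro: bipoly.zero bipoly_add)

lemma bipoly_prod:
  "(\<And>i. i \<in> A \<Longrightarrow> bipoly d (f i)) \<Longrightarrow> bipoly (card A * d) (\<lambda>Y Z. \<Prod>i\<in>A. f i Y Z)"
proof (induction A rule: infinite_finite_induct)
  case (insert i A)
  have "bipoly (d + card A * d) (\<lambda>Y Z. f i Y Z * (\<Prod>i\<in>A. f i Y Z))"
    by (intro bipoly_mult insert) (auto intro: insert)
  then show ?case using insert by simp
qed (use bipoly_monom[of 0 0 _ 1] in auto)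

text \<open>Serves to extend identities from infinitely many values of \<open>Z\<close> to all of
  them.\<close>

lemma bipoly_section:
  assumes "bipoly d f" shows "\<exists>q. \<forall>Z. f Y Z = poly q Z"
  using assms
proof induction
  case zero then show ?case by (intro exI[of _ 0]) simp
next
  case (add_monom f a b c)
  then obtain q where "\<forall>Z. f Y Z = poly q Z" by blast
  then show ?case by (intro exI[of _ "q + monom (c * Y^a) b"]) (simp add: poly_monom)
qed

lemma lagrange_power:
  assumes "a \<le> m" shows "(\<Sum>k\<le>m. lagrange_weight m k * node k ^ a) = 0 ^ a"
proof -
  have "degree (monom (1::rat) a) \<le> m" using assms degree_monom_le order.trans by blast
  from lagrange_at_zero[OF this] show ?thesis by (simp add: poly_monom)
qed

text \<open>A monomial of total degree at most \<open>2 * m + 1\<close> has degree at most \<open>m\<close> in one of the variables,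
  so the tensor product of the two interpolation error functionals kills it.\<close>

lemma bipoly_boolean_interpolation:
  assumes "bipoly (2 * m + 1) f"
  shows "f 0 0 = (\<Sum>k\<le>m. lagrange_weight m k * f (node k) 0) + (\<Sum>l\<le>m. lagrange_weight m l * f 0 (node l))
     - (\<Sum>k\<le>m. \<Sum>l\<le>m. lagrange_weight m k * lagrange_weight m l * f (node k) (node l))"
  using assms
proof induction
  case zero then show ?case by simp
next
  case (add_monom f a b c)
  define s where "s = (\<lambda>a. \<Sum>k\<le>m. lagrange_weight m k * node k ^ a)"
  have "a \<le> m \<or> b \<le> m" using add_monom.hyps(2) by linarith
  then have "(0 ^ a - s a) * (0 ^ b - s b) = 0" using lagrange_power by (auto simp: s_def)
  moreover have "c * u * v = c * s1 * v + c * u * s2 - c * s1 * s2"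
    if "(u - s1) * (v - s2) = 0" for u v s1 s2 :: rat
    using that by algebra
  ultimately have "c * 0^a * 0^b = c * s a * 0^b + c * 0^a * s b - c * s a * s b" by blast
  moreover have "(\<Sum>k\<le>m. \<Sum>l\<le>m. lagrange_weight m k * lagrange_weight m l * (c * node k ^ a * node l ^ b))
      = c * s a * s b"
    by (simp add: s_def sum_product sum_distrib_left sum_distrib_right mult_ac)
  moreover have "(\<Sum>k\<le>m. lagrange_weight m k * (c * node k ^ a * 0^b)) = c * s a * 0^b"
    by (simp add: s_def sum_distrib_left sum_distrib_right mult_ac)
  moreover have "(\<Sum>k\<le>m. lagrange_weight m k * (c * 0^a * node k ^ b)) = c * 0^a * s b"
    by (simp add: s_def sum_distrib_left sum_distrib_right mult_ac)
  ultimately show ?case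
    using add_monom.IH by (simp only: distrib_left sum.distrib)
qed

lemma bipoly_mono: assumes "bipoly d f" "d \<le> e" shows "bipoly e f"
  using assms(1) by induction (use assms(2) in \<open>auto intro: bipoly.intros\<close>)

lemma bipoly_half_sq: "bipoly n (\<lambda>Y Z. half_sq n Y)" "bipoly n (\<lambda>Y Z. half_sq n Z)"
proof -
  have "bipoly 1 (\<lambda>Y Z. (of_nat i + 1/2)^2 - Y)" for i
    using bipoly_add[OF bipoly_monom[of 0 0 1 "(of_nat i + 1/2)^2"] bipoly_monom[of 1 0 1 "-1"]] by simp
  from bipoly_prod[of "{..<n}", OF this] show "bipoly n (\<lambda>Y Z. half_sq n Y)" by (simp add: half_sq_def)
  have "bipoly 1 (\<lambda>Y Z. (of_nat i + 1/2)^2 - Z)" for i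
    using bipoly_add[OF bipoly_monom[of 0 0 1 "(of_nat i + 1/2)^2"] bipoly_monom[of 0 1 1 "-1"]] by simp
  from bipoly_prod[of "{..<n}", OF this] show "bipoly n (\<lambda>Y Z. half_sq n Z)" by (simp add: half_sq_def)
qed

lemma bipoly_affine: "bipoly 1 (\<lambda>Y Z. u + v * Y + w * Z)"
  using bipoly_add[OF bipoly_add[OF bipoly_monom[of 0 0 1 u] bipoly_monom[of 1 0 1 v]] bipoly_monom[of 0 1 1 w]]
  by simp

lemma bipoly_cross: "bipoly 2 (\<lambda>Y Z. (t - Y - Z)^2 - 4 * Y * Z)"
proof -
  have "bipoly 2 (\<lambda>Y Z. (t + (-1) * Y + (-1) * Z) * (t + (-1) * Y + (-1) * Z) + (-4) * Y^1 * Z^1)"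
    using bipoly_add[OF bipoly_mult[OF bipoly_affine[of t "-1" "-1"] bipoly_affine[of t "-1" "-1"]],
        of "\<lambda>Y Z. (-4) * Y^1 * Z^1"] bipoly_monom[of 1 1 2 "-4"] by (simp add: numeral_2_eq_2)
  then show ?thesis by (simp add: power2_eq_square)
qed

text \<open>The factors of the summand have degrees 1, \<open>n\<close>, \<open>n\<close> and
  \<open>2 * (m - n)\<close>, in total \<open>2 * m + 1\<close>, exactly the bound of the Boolean
  interpolation formula.\<close>

lemma bipoly_quintic_num: "bipoly (2 * m + 1) (quintic_num m)"
proof -
  have "bipoly (2 * m + 1) (\<lambda>Y Z. half_coeff n * (-4)^n
      * (10 * (of_nat n)^2 + 6 * of_nat n + 1 - 2 * Y - 2 * Z) * half_sq n Y * half_sq n Z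
      * (\<Prod>i=n..<m. ((of_nat i + 1)^2 - Y - Z)^2 - 4 * Y * Z))" if "n \<le> m" for n
  proof -
    have p: "bipoly ((m - n) * 2) (\<lambda>Y Z. \<Prod>i=n..<m. ((of_nat i + 1)^2 - Y - Z)^2 - 4 * Y * Z)"
      using bipoly_prod[of "{n..<m}" 2 "\<lambda>i Y Z. ((of_nat i + 1)^2 - Y - Z)^2 - 4 * Y * Z"] bipoly_cross
      by simp
    have "bipoly 1 (\<lambda>Y Z. half_coeff n * (-4)^n * (10 * (of_nat n)^2 + 6 * of_nat n + 1 - 2 * Y - 2 * Z))"
      using bipoly_affine[of "half_coeff n * (-4)^n * (10 * (of_nat n)^2 + 6 * of_nat n + 1)"
          "half_coeff n * (-4)^n * (-2)" "half_coeff n * (-4)^n * (-2)"]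
      by (simp add: algebra_simps)
    from bipoly_mult[OF bipoly_mult[OF bipoly_mult[OF this bipoly_half_sq(1)[of n]] bipoly_half_sq(2)[of n]] p]
    show ?thesis by (rule bipoly_mono) (use that in simp)
  qed
  then show ?thesis unfolding quintic_num_def[abs_def] by (intro bipoly_sum) simp
qed

text \<open>Both sides are polynomials in \<open>Z\<close> that agree for all negative
  \<open>Z\<close>. The extension makes \<open>Z = 0\<close> and \<open>Z\<close> a node
  available.\<close>

lemma quintic_num_node:
  assumes "k \<le> m"
  shows "quintic_num m (node k) Z = 2 * (node k - Z) * cross_sq m (node k) Z"
proof -
  obtain q where q: "\<And>Z. quintic_num m (node k) Z = poly q Z"
    using bipoly_section[OF bipoly_quintic_num] by blast
  have "bipoly (card {..<m} * 2) (cross_sq m)"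
    unfolding cross_sq_def[abs_def] by (intro bipoly_prod bipoly_cross)
  then obtain r where r: "\<And>Z. cross_sq m (node k) Z = poly r Z"
    using bipoly_section by blast
  define s where "s = q - [:2 * node k, -2:] * r"
  have s: "poly s Z = quintic_num m (node k) Z - 2 * (node k - Z) * cross_sq m (node k) Z" for Z
    by (simp add: s_def q r algebra_simps)
  have "{Z. Z < 0} \<subseteq> {Z. poly s Z = 0}"
    using quintic_num_node_neg[OF assms] by (auto simp: s)
  moreover have "infinite {Z :: rat. Z < 0}"
  proof -
    have "range (\<lambda>n. - of_nat (Suc n) :: rat) \<subseteq> {Z. Z < 0}" by auto
    moreover have "infinite (range (\<lambda>n. - of_nat (Suc n) :: rat))"
      by (intro range_inj_infinite) (auto simp: inj_on_def)
    ultimately show ?thesis using finite_subset by blast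
  qed
  ultimately have "s = 0" using poly_roots_finite finite_subset by blast
  then show ?thesis using s[of Z] by simp
qed

lemma quintic_num_sym: "quintic_num m Y Z = quintic_num m Z Y"
  unfolding quintic_num_def by (intro sum.cong refl) (simp add: algebra_simps)

text \<open>At a pair of nodes the explicit value is antisymmetric while \<open>quintic_num\<close>
  is symmetric, so it is 0 and the double sum drops out. By symmetry the two single sums
  coincide.\<close>

lemma quintic_num_zero:
  "quintic_num m 0 0 = (\<Sum>k\<le>m. 4 * lagrange_weight m k * node k * cross_sq m (node k) 0)"
proof -
  have z: "quintic_num m (node k) (node l) = 0" if "k \<le> m" "l \<le> m" for k l
  proof -
    have "cross_sq m (node k) (node l) = cross_sq m (node l) (node k)"
      unfolding cross_sq_def by (intro prod.cong refl) (simp add: algebra_simps)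
    then have "quintic_num m (node k) (node l) = - quintic_num m (node l) (node k)"
      unfolding quintic_num_node[OF that(1)] quintic_num_node[OF that(2)] by (simp add: algebra_simps)
    then show ?thesis using quintic_num_sym[of m "node k" "node l"] by simp
  qed
  have "quintic_num m 0 0 = 2 * (\<Sum>k\<le>m. lagrange_weight m k * quintic_num m (node k) 0)"
    using bipoly_boolean_interpolation[OF bipoly_quintic_num, of m]
    by (simp add: z quintic_num_sym[of m 0 "node _"])
  also have "\<dots> = (\<Sum>k\<le>m. 4 * lagrange_weight m k * node k * cross_sq m (node k) 0)"
    by (simp add: sum_distrib_left quintic_num_node mult_ac)
  finally show ?thesis .
qed

text \<open>Every summand is a product of \<open>n\<close> and then \<open>m - n\<close> factors
  linear in \<open>Y\<close>.\<close>

lemma cubic_num_poly: "\<exists>q. degree q \<le> m \<and> (\<forall>Y. cubic_num z m Y = poly q Y)"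
proof -
  define q where "q = (\<Sum>n\<le>m. smult (half_coeff n * z^n * (3 * of_nat n + 1))
     ((\<Prod>i<n. [:(of_nat i + 1/2)^2, -1:]) * (\<Prod>i=n..<m. [:(of_nat i + 1)^2, -4:])))"
  have lin: "degree (\<Prod>i\<in>A. [:f i, c:]) \<le> card A" if "finite A" for A :: "nat set" and f and c :: rat
  proof -
    have "degree (\<Prod>i\<in>A. [:f i, c:]) \<le> (\<Sum>i\<in>A. degree [:f i, c:])"
      by (rule degree_prod_sum_le[unfolded o_def]) (rule that)
    also have "\<dots> \<le> (\<Sum>i\<in>A. 1)" by (intro sum_mono) simp
    finally show ?thesis by simp
  qed
  have "degree ((\<Prod>i<n. [:(of_nat i + 1/2)^2, -1:]) * (\<Prod>i=n..<m. [:(of_nat i + 1)^2, -4 :: rat:])) \<le> m"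
    if "n \<le> m" for n
    using degree_mult_le[of "\<Prod>i<n. [:(of_nat i + 1/2)^2, -1 :: rat:]" "\<Prod>i=n..<m. [:(of_nat i + 1)^2, -4:]"]
      lin[of "{..<n}" "\<lambda>i. (of_nat i + 1/2)^2" "-1"] lin[of "{n..<m}" "\<lambda>i. (of_nat i + 1)^2" "-4"] that
    by simp
  then have "degree q \<le> m"
    unfolding q_def by (intro degree_sum_le) (auto intro: order.trans[OF degree_smult_le])
  moreover have "cubic_num z m Y = poly q Y" for Y
    by (simp add: q_def cubic_num_def poly_sum poly_prod half_sq_def mult_ac)
  ultimately show ?thesis by blast
qed

lemma cubic_num_zero:
  "cubic_num z m 0 = (\<Sum>k\<le>m. lagrange_weight m k * (\<Sum>n\<le>k. cubic_term z n (node k)) * int_sq m (node k))"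
proof -
  obtain q where q: "degree q \<le> m" "\<And>Y. cubic_num z m Y = poly q Y" using cubic_num_poly by blast
  show ?thesis unfolding q(2) lagrange_at_zero[OF q(1)] unfolding q(2)[symmetric]
    by (intro sum.cong refl) (simp add: cubic_num_node mult_ac)
qed

section \<open>Arithmetic in the localization\<close>

text \<open>The definition refers to lowest terms; since a reduced denominator divides every other
  one, any representation with denominator prime to \<open>p\<close> will do.\<close>

lemma rat_localization_iff:
  "x \<in> rat_localization p \<longleftrightarrow> (\<exists>a b. x = of_int a / of_int b \<and> \<not> int p dvd b)"
proof
  assume "x \<in> rat_localization p"
  then show "\<exists>a b. x = of_int a / of_int b \<and> \<not> int p dvd b"
    unfolding rat_localization_def
    by (metis mem_Collect_eq prod.collapse quotient_of_div)
next
  assume "\<exists>a b. x = of_int a / of_int b \<and> \<not> int p dvd b"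
  then obtain a b where ab: "x = of_int a / of_int b" "\<not> int p dvd b" by blast
  obtain c d where cd: "quotient_of x = (c, d)" by (cases "quotient_of x")
  have x: "x = of_int c / of_int d" and d: "d > 0" and cop: "coprime c d"
    using cd by (auto dest: quotient_of_div quotient_of_denom_pos quotient_of_coprime)
  have "b \<noteq> 0" using ab by auto
  then have "(of_int (a * d) :: rat) = of_int (c * b)"
    using x ab(1) d by (simp add: field_simps)
  then have "a * d = c * b" by (simp only: of_int_eq_iff)
  then have "d dvd c * b" by (metis dvd_triv_right)
  then have "d dvd b" using cop coprime_commute coprime_dvd_mult_right_iff by blast
  then show "x \<in> rat_localization p"
    using ab(2) cd dvd_trans by (auto simp: rat_localization_def)
qed

locale prime_localization =
  fixes p :: nat
  assumes prime: "prime p"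
begin

abbreviation R :: "rat set" where "R \<equiv> rat_localization p"

lemma R_of_int [simp]: "of_int a \<in> R"
proof -
  have "\<not> int p dvd 1" using prime_gt_1_nat[OF prime] by simp
  then show ?thesis unfolding rat_localization_iff by (intro exI[of _ a] exI[of _ 1]) simp
qed

lemma R_of_nat [simp]: "of_nat a \<in> R" using R_of_int[of "int a"] by simp
lemma R_numeral [simp]: "numeral a \<in> R" using R_of_int[of "numeral a"] by simp
lemma R_0 [simp]: "0 \<in> R" using R_of_int[of 0] by simp
lemma R_1 [simp]: "1 \<in> R" using R_of_int[of 1] by simp

lemma R_add: assumes "x \<in> R" "y \<in> R" shows "x + y \<in> R"
proof -
  obtain a b c d where *: "x = of_int a / of_int b" "\<not> int p dvd b" "y = of_int c / of_int d" "\<not> int p dvd d"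
    using assms unfolding rat_localization_iff by blast
  then have "b \<noteq> 0" "d \<noteq> 0" by auto
  then have "x + y = of_int (a * d + c * b) / of_int (b * d)" using * by (simp add: field_simps)
  moreover have "\<not> int p dvd b * d" using * prime by (simp add: prime_dvd_mult_iff)
  ultimately show ?thesis unfolding rat_localization_iff by blast
qed

lemma R_mult: assumes "x \<in> R" "y \<in> R" shows "x * y \<in> R"
proof -
  obtain a b c d where *: "x = of_int a / of_int b" "\<not> int p dvd b" "y = of_int c / of_int d" "\<not> int p dvd d"
    using assms unfolding rat_localization_iff by blast
  then have "x * y = of_int (a * c) / of_int (b * d)" by simp
  moreover have "\<not> int p dvd b * d" using * prime by (simp add: prime_dvd_mult_iff)
  ultimately show ?thesis unfolding rat_localization_iff by blast
qed

lemma R_uminus: "x \<in> R \<Longrightarrow> - x \<in> R" using R_mult[OF R_of_int[of "-1"], of x] by simp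
lemma R_diff: "x \<in> R \<Longrightarrow> y \<in> R \<Longrightarrow> x - y \<in> R" using R_add[of x "- y"] R_uminus by simp
lemma R_power: "x \<in> R \<Longrightarrow> x ^ n \<in> R" by (induction n) (auto intro: R_mult)
lemma R_sum: "(\<And>i. i \<in> A \<Longrightarrow> f i \<in> R) \<Longrightarrow> sum f A \<in> R"
  by (induction A rule: infinite_finite_induct) (auto intro: R_add)
lemma R_prod: "(\<And>i. i \<in> A \<Longrightarrow> f i \<in> R) \<Longrightarrow> prod f A \<in> R"
  by (induction A rule: infinite_finite_induct) (auto intro: R_mult)

lemma R_divide_int: assumes "x \<in> R" "\<not> int p dvd b" shows "x / of_int b \<in> R"
proof -
  have "1 / of_int b \<in> R" using assms(2) unfolding rat_localization_iff by (metis of_int_1)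
  from R_mult[OF assms(1) this] show ?thesis by simp
qed

lemma R_divide_nat: assumes "x \<in> R" "\<not> p dvd b" shows "x / of_nat b \<in> R"
  using R_divide_int[OF assms(1), of "int b"] assms(2) by simp

section \<open>The ideals generated by powers of p\<close>

definition P :: "nat \<Rightarrow> rat set" where
  "P k = {x. \<exists>z\<in>R. x = of_nat p ^ k * z}"

lemma PI: "z \<in> R \<Longrightarrow> of_nat p ^ k * z \<in> P k" by (auto simp: P_def)
lemma P_1I: "z \<in> R \<Longrightarrow> of_nat p * z \<in> P 1" using PI[of z 1] by simp
lemma P_0 [simp]: "0 \<in> P k" using PI[of 0 k] by simp

lemma P_add: assumes "x \<in> P k" "y \<in> P k" shows "x + y \<in> P k"
proof -
  obtain u v where "u \<in> R" "v \<in> R" "x = of_nat p ^ k * u" "y = of_nat p ^ k * v"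
    using assms by (auto simp: P_def)
  then show ?thesis using PI[OF R_add, of u v k] by (simp add: distrib_left)
qed

lemma P_mult: assumes "x \<in> P k" "y \<in> P l" shows "x * y \<in> P (k + l)"
proof -
  obtain u v where "u \<in> R" "v \<in> R" "x = of_nat p ^ k * u" "y = of_nat p ^ l * v"
    using assms by (auto simp: P_def)
  then show ?thesis using PI[OF R_mult, of u v "k + l"] by (simp add: power_add mult_ac)
qed

lemma P_zero_iff: "x \<in> P 0 \<longleftrightarrow> x \<in> R" by (simp add: P_def)

lemma P_mult_R: "x \<in> P k \<Longrightarrow> y \<in> R \<Longrightarrow> x * y \<in> P k"
  using P_mult[of x k y 0] by (simp add: P_zero_iff)
lemma P_mult_R': "x \<in> R \<Longrightarrow> y \<in> P k \<Longrightarrow> x * y \<in> P k"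
  using P_mult_R[of y k x] by (simp add: mult.commute)
lemma P_uminus: "x \<in> P k \<Longrightarrow> - x \<in> P k" using P_mult_R[of x k "- 1"] R_uminus[of 1] by simp
lemma P_diff: "x \<in> P k \<Longrightarrow> y \<in> P k \<Longrightarrow> x - y \<in> P k" using P_add[of x k "- y"] P_uminus by simp
lemma P_sum: "(\<And>i. i \<in> A \<Longrightarrow> f i \<in> P k) \<Longrightarrow> sum f A \<in> P k"
  by (induction A rule: infinite_finite_induct) (auto intro: P_add)

lemma P_mono: assumes "x \<in> P k" "l \<le> k" shows "x \<in> P l"
proof -
  obtain u where u: "u \<in> R" "x = of_nat p ^ k * u" using assms by (auto simp: P_def)
  have "x = of_nat p ^ l * (of_nat p ^ (k - l) * u)"
    using u assms(2) by (simp flip: power_add add: mult.assoc[symmetric])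
  then show ?thesis using PI[of "of_nat p ^ (k - l) * u" l] u(1) by (simp add: R_mult R_power)
qed

lemma P_R: "x \<in> P k \<Longrightarrow> x \<in> R" using P_mono[of x k 0] by (simp add: P_zero_iff)

lemma P_prod_member:
  assumes "finite A" "i \<in> A" "f i \<in> P k" "\<And>j. j \<in> A \<Longrightarrow> f j \<in> R" shows "prod f A \<in> P k"
  using P_mult_R[OF assms(3) R_prod[of "A - {i}" f]] assms(1,2,4) by (simp add: prod.remove)

lemma P_prod_diff:
  assumes "\<And>i. i \<in> A \<Longrightarrow> f i \<in> R" "\<And>i. i \<in> A \<Longrightarrow> g i \<in> R" "\<And>i. i \<in> A \<Longrightarrow> f i - g i \<in> P k"
  shows "prod f A - prod g A \<in> P k"
  using assms
proof (induction A rule: infinite_finite_induct)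
  case (insert i A)
  have "prod f (insert i A) - prod g (insert i A) = (f i - g i) * prod f A + g i * (prod f A - prod g A)"
    using insert.hyps by (simp add: algebra_simps)
  moreover have "\<dots> \<in> P k"
    by (intro P_add P_mult_R P_mult_R' insert R_prod) (auto intro: insert)
  ultimately show ?case by simp
qed auto

text \<open>Products of two or more corrections are divisible by \<open>p^4\<close>, so only the
  linear part survives modulo \<open>p^3\<close>.\<close>

lemma P_prod_one_plus:
  assumes "\<And>i. i \<in> A \<Longrightarrow> x i \<in> R"
  shows "(\<Prod>i\<in>A. 1 + of_nat p ^ 2 * x i) - 1 - of_nat p ^ 2 * sum x A \<in> P 3"
  using assms
proof (induction A rule: infinite_finite_induct)
  case (insert i A)
  define u where "u = (\<Prod>i\<in>A. 1 + of_nat p ^ 2 * x i) - 1 - of_nat p ^ 2 * sum x A"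
  have u: "u \<in> P 3" unfolding u_def by (intro insert.IH) (auto intro: insert)
  have xi: "x i \<in> R" and s: "sum x A \<in> R" by (auto intro!: R_sum insert.prems)
  have "(\<Prod>i\<in>insert i A. 1 + of_nat p ^ 2 * x i) - 1 - of_nat p ^ 2 * sum x (insert i A)
     = (1 + of_nat p ^ 2 * x i) * u + of_nat p ^ 3 * (of_nat p * x i * sum x A)"
    unfolding u_def using insert.hyps by simp algebra
  moreover have "\<dots> \<in> P 3"
    by (intro P_add P_mult_R' u PI R_add R_mult R_power xi s) auto
  ultimately show ?case by simp
qed auto

lemma not_dvd_fact: "n < p \<Longrightarrow> \<not> p dvd fact n"
  using prime by (simp add: prime_dvd_fact_iff)

lemma R_divide_fact: "x \<in> R \<Longrightarrow> n < p \<Longrightarrow> x / fact n \<in> R"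
  using R_divide_nat[of x "fact n"] not_dvd_fact by simp

lemma not_dvd_mult: "\<not> int p dvd a \<Longrightarrow> \<not> int p dvd b \<Longrightarrow> \<not> int p dvd a * b"
  using prime by (simp add: prime_dvd_mult_iff)

lemma int_not_dvd: "a \<noteq> 0 \<Longrightarrow> \<bar>a\<bar> < int p \<Longrightarrow> \<not> int p dvd a"
  using dvd_imp_le_int by force

end

section \<open>Divisibility of nodes, weights and denominators by an odd prime\<close>

locale odd_prime_localization = prime_localization +
  fixes m :: nat
  assumes p_eq: "p = 2 * m + 1" and m_pos: "m > 0"
begin

lemma not_dvd_2: "\<not> int p dvd 2"
  using p_eq m_pos by (intro int_not_dvd) auto

lemma not_dvd_4: "\<not> int p dvd 4"
  using not_dvd_mult[OF not_dvd_2 not_dvd_2] by simp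

lemma R_half: "x \<in> R \<Longrightarrow> x / 2 \<in> R" "x \<in> R \<Longrightarrow> x / 4 \<in> R"
  using R_divide_int[of x 2] R_divide_int[of x 4] not_dvd_2 not_dvd_4 by auto

lemma node_R: "node k \<in> R"
  unfolding node_def by (intro R_power R_add R_half) auto

lemma node_diff: "node i - node k = (of_nat i - of_nat k) * (of_nat i + of_nat k + 1)"
  by (simp add: node_def) algebra

text \<open>The factors \<open>i - k\<close> and \<open>i + k + 1\<close> of the difference are
  nonzero and at most \<open>2 * m < p\<close> in absolute value.\<close>

lemma node_diff_inverse_R:
  assumes "i \<noteq> k" "i \<le> m" "k \<le> m" shows "1 / (node i - node k) \<in> R"
proof -
  have "node i - node k = of_int ((int i - int k) * (int i + int k + 1))"
    by (simp add: node_diff)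
  moreover have "\<not> int p dvd (int i - int k) * (int i + int k + 1)"
    using assms p_eq by (intro not_dvd_mult int_not_dvd) auto
  ultimately show ?thesis using R_divide_int[OF R_1] by (simp only:)
qed

lemma node_ratio_R:
  assumes "i \<noteq> k" "i \<le> m" "k \<le> m" shows "node i / (node i - node k) \<in> R"
  using R_mult[OF node_R[of i] node_diff_inverse_R[OF assms]] by simp

lemma node_last: "node m = of_nat p ^ 2 * (1 / 4)"
  by (simp add: node_def p_eq power2_eq_square) algebra

lemma node_last_P: "node m \<in> P 2"
  unfolding node_last by (intro PI R_half) auto

text \<open>The factor with \<open>i = m\<close> has numerator \<open>p^2 / 4\<close> and a
  denominator prime to \<open>p\<close>.\<close>

lemma lagrange_weight_P:
  assumes "k < m" shows "lagrange_weight m k \<in> P 2"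
  unfolding lagrange_weight_def
proof (rule P_prod_member[where i = m])
  show "node m / (node m - node k) \<in> P 2"
    using P_mult_R[OF node_last_P node_diff_inverse_R[of m k]] assms by simp
qed (use assms in \<open>auto intro: node_ratio_R\<close>)

lemma lagrange_weight_last: "lagrange_weight m m = (\<Prod>i<m. 1 + of_nat p ^ 2 * (1 / 4 / (node i - node m)))"
proof -
  have "{..m} - {m} = {..<m}" by auto
  moreover have "node i / (node i - node m) = 1 + of_nat p ^ 2 * (1 / 4 / (node i - node m))" if "i < m" for i
  proof -
    have "node i - node m \<noteq> 0" using that node_inj[of i m] by simp
    then have "node i / (node i - node m) = 1 + node m / (node i - node m)" by (simp add: field_simps)
    then show ?thesis unfolding node_last by simp
  qed
  ultimately show ?thesis unfolding lagrange_weight_def by (intro prod.cong) auto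
qed

lemma last_ratio_R: assumes "i < m" shows "1 / 4 / (node i - node m) \<in> R"
proof -
  have "1 / (node i - node m) \<in> R" using assms by (intro node_diff_inverse_R) auto
  from R_mult[OF R_half(2)[OF R_1] this] show ?thesis
    by (simp only: times_divide_eq_right mult_1_right)
qed

lemma int_sq_node_P:
  assumes "k < m" shows "int_sq m (node k) \<in> P 1"
proof -
  \<comment> \<open>In \<open>(i - 2*k) * (i + 2*k + 2)\<close> the first factor is 0 at
    \<open>i = 2 * k\<close>; if that index is not below \<open>m\<close>, the index
    \<open>2 * m - 1 - 2 * k\<close> is, and it makes the second factor \<open>p\<close>.\<close>
  define i where "i = (if 2 * k < m then 2 * k else 2 * m - 1 - 2 * k)"
  show ?thesis unfolding int_sq_def
  proof (rule P_prod_member[where i = i])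
    show "i \<in> {..<m}" using assms by (auto simp: i_def)
    show "(of_nat i + 1)^2 - 4 * node k \<in> P 1"
    proof (cases "2 * k < m")
      case True
      then show ?thesis unfolding int_sq_factor by (simp add: i_def)
    next
      case False
      then have "int i + 2 * int k + 2 = int p" using assms p_eq by (simp add: i_def)
      then have "(of_nat i + 1)^2 - 4 * node k = of_nat p * of_int (int i - 2 * int k)"
        unfolding int_sq_factor by simp
      then show ?thesis by (simp only: P_1I R_of_int)
    qed
  qed (auto simp only: int_sq_factor R_of_int finite_lessThan)
qed

lemma prod_squares: "(\<Prod>i<n. (of_nat i + 1)^2 :: rat) = (fact n)^2"
  by (induction n) (auto simp: algebra_simps power2_eq_square)

text \<open>Below the last node the weight supplies \<open>p^2\<close> and the denominator
  \<open>p\<close>. At the last node \<open>2 * m + 1 = p\<close> is a factor, so the rest matters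
  only modulo \<open>p^2\<close>. The sequence \<open>e\<close> covers both sign patterns.\<close>

lemma cubic_num_zero_cong:
  assumes v: "\<And>k. (\<Sum>n\<le>k. cubic_term z n (node k)) = e k * (2 * of_nat k + 1)" and e: "\<And>k. e k \<in> R"
  shows "cubic_num z m 0 - e m * of_nat p * (fact m)^2 \<in> P 3"
proof -
  define t where "t = (\<lambda>k. lagrange_weight m k * (e k * (2 * of_nat k + 1)) * int_sq m (node k))"
  have "cubic_num z m 0 = (\<Sum>k<m. t k) + t m"
    unfolding cubic_num_zero v t_def by (simp flip: lessThan_Suc_atMost)
  moreover have "(\<Sum>k<m. t k) \<in> P 3"
  proof (rule P_sum)
    fix k assume "k \<in> {..<m}"
    then have "lagrange_weight m k * (e k * (2 * of_nat k + 1)) * int_sq m (node k) \<in> P (2 + 1)"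
      by (intro P_mult P_mult_R lagrange_weight_P int_sq_node_P R_mult R_add e) auto
    then show "t k \<in> P 3" by (simp add: t_def)
  qed
  moreover have "t m - e m * of_nat p * (fact m)^2 \<in> P 3"
  proof -
    have l: "lagrange_weight m m - 1 \<in> P 2"
    proof -
      have "lagrange_weight m m - (\<Prod>i<m. 1) \<in> P 2" unfolding lagrange_weight_last
        by (intro P_prod_diff) (auto simp only: add_diff_cancel_left' intro!: PI R_add R_mult R_power R_1 R_of_nat last_ratio_R)
      then show ?thesis by simp
    qed
    have i: "int_sq m (node m) - (fact m)^2 \<in> P 2"
    proof -
      have "int_sq m (node m) - (\<Prod>i<m. (of_nat i + 1)^2) \<in> P 2" unfolding int_sq_def
      proof (intro P_prod_diff)
        fix i
        show "(of_nat i + 1)^2 - 4 * node m - (of_nat i + 1)^2 \<in> P 2"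
          using P_mult_R[OF node_last_P, of "-4"] R_uminus[of 4] by (simp add: mult.commute)
      qed (auto simp: node_R intro!: R_diff R_mult R_power R_add)
      then show ?thesis by (simp add: prod_squares)
    qed
    have p: "2 * of_nat m + 1 = (of_nat p :: rat)" by (simp add: p_eq)
    have "t m - e m * of_nat p * (fact m)^2 = (of_nat p * e m) *
       ((lagrange_weight m m - 1) * int_sq m (node m) + (int_sq m (node m) - (fact m)^2))"
      unfolding t_def p by algebra
    also have "\<dots> \<in> P (1 + 2)"
      by (intro P_mult P_1I P_add P_mult_R l i e)
        (auto simp: int_sq_def node_R intro!: R_prod R_diff R_mult R_power R_add)
    finally show ?thesis by (simp add: numeral_3_eq_3)
  qed
  ultimately show ?thesis using P_add by (metis add_diff_eq)
qed

end

section \<open>Weights of the quintic interpolation formula\<close>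

text \<open>The product of the Pochhammer symbols of \<open>1 + y\<close> and \<open>1 - y\<close>;
  its square is the common denominator at \<open>Z = 0\<close>.\<close>

definition int_half_prod :: "nat \<Rightarrow> rat \<Rightarrow> rat" where
  "int_half_prod n y = (\<Prod>i<n. (of_nat i + 1)^2 - y^2)"

lemma int_half_prod_shift:
  "int_half_prod n (y + 1) * ((1 + y) * (of_nat n - y)) = - int_half_prod n y * ((of_nat n + 1 + y) * y)"
proof (induction n)
  case 0 show ?case by (simp add: int_half_prod_def)
next
  case (Suc n)
  have "int_half_prod (Suc n) (y + 1) * ((1 + y) * (of_nat (Suc n) - y))
     = (int_half_prod n (y + 1) * ((1 + y) * (of_nat n - y))) * ((of_nat n + 2 + y) * (of_nat n + 1 - y))"
    by (simp add: int_half_prod_def) algebra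
  also have "\<dots> = - int_half_prod (Suc n) y * ((of_nat (Suc n) + 1 + y) * y)"
    unfolding Suc.IH by (simp add: int_half_prod_def) algebra
  finally show ?case .
qed

lemma cross_sq_zero: "cross_sq n (y^2) 0 = (int_half_prod n y)^2"
  by (simp add: cross_sq_def int_half_prod_def prod_power_distrib)

definition node_vandermonde :: "nat \<Rightarrow> nat \<Rightarrow> rat" where
  "node_vandermonde m k = (\<Prod>i\<in>{..m} - {k}. node i - node k)"

text \<open>In the differences \<open>(i - k) * (i + k + 1)\<close> the first factors multiply to
  \<open>(-1)^k * k! * (m-k)!\<close> and the second ones to \<open>(m+k+1)!\<close> divided by
  \<open>k! * (2*k+1)\<close>.\<close>

lemma node_vandermonde_closed:
  assumes "k \<le> m"
  shows "node_vandermonde m k * (2 * of_nat k + 1) = (-1)^k * fact (m - k) * fact (m + k + 1)"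
  using assms
proof (induction m rule: dec_induct)
  case base
  have "{..k} - {k} = {..<k}" by auto
  then have "node_vandermonde k k = (\<Prod>i<k. (-1) * of_nat (k - i) * (of_nat k + 1 + of_nat i))"
    unfolding node_vandermonde_def
    by (intro prod.cong) (auto simp: node_def of_nat_diff power2_eq_square algebra_simps)
  also have "\<dots> = (-1)^k * (\<Prod>i<k. of_nat (k - i)) * (\<Prod>i<k. of_nat k + 1 + of_nat i)"
    by (simp only: prod.distrib prod_constant card_lessThan)
  also have "(\<Prod>i<k. of_nat (k - i) :: rat) = fact k"
    by (simp add: fact_prod_rev lessThan_atLeast0)
  also have "(\<Prod>i<k. of_nat k + 1 + of_nat i :: rat) = pochhammer (of_nat k + 1) k"
    by (simp add: pochhammer_prod lessThan_atLeast0)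
  also have "(-1)^k * fact k * pochhammer (of_nat k + 1) k = ((-1)^k * fact (k + k) :: rat)"
    using pochhammer_product'[of "1::rat" k k] by (simp add: pochhammer_fact add.commute)
  finally show ?case by (simp add: algebra_simps)
next
  case (step m)
  have "{..Suc m} - {k} = insert (Suc m) ({..m} - {k})" using step by auto
  then have "node_vandermonde (Suc m) k = (node (Suc m) - node k) * node_vandermonde m k"
    by (simp add: node_vandermonde_def)
  also have "node (Suc m) - node k = (of_nat (Suc m - k)) * (of_nat m + of_nat k + 2)"
    using step by (simp add: node_def of_nat_diff power2_eq_square algebra_simps)
  finally have "node_vandermonde (Suc m) k * (2 * of_nat k + 1)
     = of_nat (Suc m - k) * (of_nat m + of_nat k + 2) * (node_vandermonde m k * (2 * of_nat k + 1))"
    by simp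
  also have "\<dots> = (-1)^k * (of_nat (Suc m - k) * fact (m - k)) * ((of_nat m + of_nat k + 2) * fact (m + k + 1))"
    unfolding step.IH by simp
  also have "of_nat (Suc m - k) * fact (m - k) = (fact (Suc m - k) :: rat)"
    using step by (simp add: Suc_diff_le)
  also have "(of_nat m + of_nat k + 2) * fact (m + k + 1) = (fact (Suc m + k + 1) :: rat)"
    by (simp add: algebra_simps)
  finally show ?case .
qed

lemma node_vandermonde_step:
  assumes "k < m"
  shows "node_vandermonde m (Suc k) * ((2 * of_nat k + 3) * (of_nat m - of_nat k))
       = - node_vandermonde m k * ((2 * of_nat k + 1) * (of_nat m + of_nat k + 2))"
proof -
  obtain j where j: "m = Suc (k + j)" using assms less_imp_Suc_add by blast
  have "node_vandermonde m (Suc k) * (2 * of_nat k + 3) = - ((-1)^k * fact j * fact (m + k + 2))"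
    using node_vandermonde_closed[of "Suc k" m] by (simp add: j add_ac)
  moreover have "node_vandermonde m k * (2 * of_nat k + 1) = (-1)^k * fact (Suc j) * fact (m + k + 1)"
    using node_vandermonde_closed[of k m] by (simp add: j)
  moreover have "fact (Suc j) = (of_nat m - of_nat k) * (fact j :: rat)" by (simp add: j)
  moreover have "fact (m + k + 2) = (of_nat m + of_nat k + 2) * (fact (m + k + 1) :: rat)"
    by (simp add: algebra_simps)
  moreover have "W * (a * d) = - U * (c * h)"
    if "W * a = - (s * f * g')" "U * c = s * f' * g" "f' = d * f" "g' = h * g"
    for W U a c d h s f f' g g' :: rat
    using that by algebra
  ultimately show ?thesis by blast
qed

lemma node_vandermonde_nonzero: "node_vandermonde m k \<noteq> 0"
  by (auto simp: node_vandermonde_def node_inj)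

text \<open>The factor \<open>node k\<close> completes the numerator to a product independent of
  \<open>k\<close>, so consecutive weights can be compared through \<open>node_vandermonde\<close>
  alone.\<close>

lemma lagrange_weight_vandermonde:
  assumes "k \<le> m"
  shows "lagrange_weight m k * node k = (\<Prod>i\<le>m. node i) / node_vandermonde m k"
proof -
  have "(\<Prod>i\<le>m. node i) = node k * (\<Prod>i\<in>{..m} - {k}. node i)"
    using assms by (intro prod.remove) auto
  then show ?thesis
    unfolding lagrange_weight_def node_vandermonde_def by (simp add: prod_dividef)
qed

section \<open>Summands of the quintic interpolation formula modulo \<open>p^5\<close>\<close>

context odd_prime_localization
begin

definition quintic_part :: "nat \<Rightarrow> rat" where
  "quintic_part k = 4 * lagrange_weight m k * node k * cross_sq m (node k) 0"

text \<open>The quotient of consecutive values of \<open>quintic_part k * (2*k+1)^2\<close>. The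
  square is there because the quotient then becomes 1 when \<open>p\<close> is formally set to
  0.\<close>

definition quintic_part_ratio :: "nat \<Rightarrow> rat" where
  "quintic_part_ratio k = - ((of_nat p + 2 * of_nat k + 2)^2 * (2 * of_nat k + 3) * (of_nat p - 2 * of_nat k - 1))
     / ((of_nat p - 2 * of_nat k - 2)^2 * (2 * of_nat k + 1) * (of_nat p + 2 * of_nat k + 3))"

lemma quintic_part_Suc:
  assumes "k < m"
  shows "quintic_part (Suc k) * (2 * of_nat k + 3)^2 = quintic_part k * (2 * of_nat k + 1)^2 * quintic_part_ratio k"
proof -
  define X where "X = (\<Prod>i\<le>m. node i)"
  define y :: rat where "y = of_nat k + 1/2"
  define K :: rat where "K = of_nat k"
  define q :: rat where "q = of_nat p"
  define V V' b b' where "V = node_vandermonde m k" and "V' = node_vandermonde m (Suc k)"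
    and "b = int_half_prod m y" and "b' = int_half_prod m (y + 1)"
  have quintic_part: "quintic_part k = 4 * X * b^2 / V" "quintic_part (Suc k) = 4 * X * b'^2 / V'"
  proof -
    have "quintic_part k = 4 * (lagrange_weight m k * node k) * cross_sq m (y^2) 0"
      by (simp add: quintic_part_def node_def y_def)
    then show "quintic_part k = 4 * X * b^2 / V"
      using assms by (simp add: lagrange_weight_vandermonde cross_sq_zero X_def b_def V_def)
    have "quintic_part (Suc k) = 4 * (lagrange_weight m (Suc k) * node (Suc k)) * cross_sq m ((y+1)^2) 0"
      by (simp add: quintic_part_def node_def y_def add_ac)
    then show "quintic_part (Suc k) = 4 * X * b'^2 / V'"
      using assms by (simp add: lagrange_weight_vandermonde cross_sq_zero X_def b'_def V'_def)
  qed
  \<comment> \<open>Trading \<open>m\<close> for \<open>p\<close> brings all linear factors into the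
    form used in the ratio.\<close>
  have M: "of_nat m = (q - 1) / 2" by (simp add: q_def p_eq)
  have "K \<ge> 0" "q > 2 * K + 2"
  proof -
    have "2 * k + 2 < p" using assms p_eq by simp
    then have "(of_nat (2 * k + 2) :: rat) < of_nat p" by (simp only: of_nat_less_iff)
    then show "q > 2 * K + 2" by (simp add: q_def K_def)
  qed (simp add: K_def)
  then have nz: "q - 2*K - 2 \<noteq> 0" "2*K+1 \<noteq> 0" "2*K+3 \<noteq> 0" "q+2*K+3 \<noteq> 0" "q - 2*K - 1 \<noteq> 0" by auto
  have "V \<noteq> 0" "V' \<noteq> 0" by (simp_all add: V_def V'_def node_vandermonde_nonzero)
  have hV: "V' * ((2*K+3) * (q - 2*K - 1)) = - V * ((2*K+1) * (q + 2*K + 3))"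
    using node_vandermonde_step[OF assms] unfolding V_def V'_def M K_def by (simp add: field_simps)
  have hb: "b' * ((2*K+3) * (q - 2*K - 2)) = - b * ((q + 2*K + 2) * (2*K+1))"
    using int_half_prod_shift[of m y] unfolding b_def[symmetric] b'_def[symmetric] M
    by (simp add: y_def K_def[symmetric] field_simps)
  have "quintic_part (Suc k) * (2*K+3)^2 = 4 * X * (b' * ((2*K+3) * (q - 2*K - 2)))^2 / (V' * (q - 2*K - 2)^2)"
    unfolding quintic_part using nz by (simp add: power_mult_distrib)
  also have "\<dots> = 4 * X * b^2 * ((q + 2*K + 2) * (2*K+1))^2 / (V' * (q - 2*K - 2)^2)"
    unfolding hb by (simp add: power_mult_distrib)
  also have "V' = - V * ((2*K+1) * (q + 2*K + 3)) / ((2*K+3) * (q - 2*K - 1))"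
    using nz by (simp only: nonzero_eq_divide_eq hV mult_eq_0_iff simp_thms)
  also have "4 * X * b^2 * ((q + 2*K + 2) * (2*K+1))^2 /
       (- V * ((2*K+1) * (q + 2*K + 3)) / ((2*K+3) * (q - 2*K - 1)) * (q - 2*K - 2)^2)
     = quintic_part k * (2*K+1)^2 * (- ((q + 2*K + 2)^2 * (2*K+3) * (q - 2*K - 1))
     / ((q - 2*K - 2)^2 * (2*K+1) * (q + 2*K + 3)))"
    unfolding quintic_part using nz \<open>V \<noteq> 0\<close> by (simp add: power_mult_distrib mult_ac)
  finally show ?thesis unfolding quintic_part_ratio_def K_def q_def .
qed

text \<open>For \<open>Suc k < m\<close> the denominator is prime to \<open>p\<close>. At
  \<open>Suc k = m\<close> its factor \<open>p + 2*k + 3\<close> would be \<open>2 * p\<close>, so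
  the last node is treated separately.\<close>

lemma quintic_part_ratio_cong:
  assumes "Suc k < m" shows "quintic_part_ratio k - 1 \<in> P 1"
proof -
  define a q :: int where "a = 2 * int k + 1" and "q = int p"
  define D where "D = (q - a - 1)^2 * a * (q + a + 2)"
  define N where "N = - ((q + a + 1)^2 * (a + 2) * (q - a))"
  \<comment> \<open>\<open>E\<close> is the quotient of \<open>N - D\<close> by \<open>q\<close>: as
    polynomials in \<open>q\<close> both have the constant term
    \<open>a * (a+1)^2 * (a+2)\<close>.\<close>
  define E where "E = - (a+2) * (q^2 + 2*q*(a+1) + (a+1)^2 - a*q - 2*a*(a+1))
      - a * (q^2 - 2*q*(a+1) + (a+1)^2 + (a+2) * (q - 2*(a+1)))"
  have ND: "N - D = q * E" unfolding N_def D_def E_def by algebra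
  have lt: "0 < a" "a + 2 < q" using assms p_eq by (auto simp: a_def q_def)
  have "\<not> int p dvd q + a + 2"
  proof
    assume "int p dvd q + a + 2"
    then have "int p dvd a + 2" unfolding q_def by (simp add: add.assoc)
    then show False using lt int_not_dvd[of "a + 2"] by (simp add: q_def)
  qed
  moreover have "\<not> int p dvd q - a - 1" "\<not> int p dvd a"
    using lt by (intro int_not_dvd; simp add: q_def)+
  ultimately have D: "\<not> int p dvd D"
    unfolding D_def power2_eq_square by (intro not_dvd_mult)
  then have "D \<noteq> 0" by auto
  have "quintic_part_ratio k = of_int N / of_int D"
    unfolding quintic_part_ratio_def N_def D_def by (simp add: a_def q_def add_ac)
  then have "quintic_part_ratio k - 1 = of_int (N - D) / of_int D" using \<open>D \<noteq> 0\<close> by (simp add: field_simps)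
  also have "\<dots> = of_nat p * (of_int E / of_int D)" unfolding ND by (simp add: q_def)
  also have "\<dots> \<in> P 1" by (intro P_1I R_divide_int D R_of_int)
  finally show ?thesis .
qed

text \<open>Two powers of \<open>p\<close> come from \<open>node m\<close> in the product of the
  nodes, two from the square of \<open>int_half_prod\<close>, whose last factor is
  \<open>m^2 - 1/4 = p * (p-2) / 4\<close>.\<close>

lemma quintic_part_0_P: "quintic_part 0 \<in> P 4"
proof -
  have "(\<Prod>i\<le>m. node i) \<in> P 2"
    by (rule P_prod_member[where i = m]) (auto intro: node_last_P node_R)
  moreover have "1 / node_vandermonde m 0 \<in> R"
  proof -
    have "node_vandermonde m 0 = fact m * fact (m + 1)"
      using node_vandermonde_closed[of 0 m] by simp
    moreover have "1 / fact m / fact (m + 1) \<in> R"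
      using p_eq m_pos by (intro R_divide_fact R_1) auto
    ultimately show ?thesis by (simp only: divide_divide_eq_left)
  qed
  moreover have "int_half_prod m (1/2) \<in> P 1"
    unfolding int_half_prod_def
  proof (rule P_prod_member[where i = "m - 1"])
    have "(of_nat (m - 1) + 1)^2 - (1/2)^2 = of_nat p * ((of_nat p - 2) / 4 :: rat)"
      using m_pos by (simp add: of_nat_diff p_eq power2_eq_square field_simps)
    moreover have "\<dots> \<in> P 1" by (intro P_1I R_half R_diff) auto
    ultimately show "(of_nat (m - 1) + 1)^2 - (1/2)^2 \<in> P 1" by (simp only:)
  qed (use m_pos in \<open>auto intro!: R_diff R_power R_add R_half\<close>)
  then have "int_half_prod m (1/2) ^ 2 \<in> P 2"
    using P_mult[of "int_half_prod m (1/2)" 1 "int_half_prod m (1/2)" 1]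
    by (simp only: power2_eq_square one_add_one)
  ultimately have "4 * ((\<Prod>i\<le>m. node i) * (1 / node_vandermonde m 0) * int_half_prod m (1/2) ^ 2) \<in> P (2 + 2)"
    by (intro P_mult_R' P_mult P_mult_R) auto
  moreover have "quintic_part 0 = 4 * (lagrange_weight m 0 * node 0) * cross_sq m ((1/2)^2) 0"
    by (simp add: quintic_part_def node_def)
  ultimately show ?thesis
    by (simp add: lagrange_weight_vandermonde cross_sq_zero mult.assoc)
qed

lemma odd_square_inverse_R: "k < m \<Longrightarrow> x \<in> R \<Longrightarrow> x / (2 * of_nat k + 1)^2 \<in> R"
proof -
  assume k: "k < m" and x: "x \<in> R"
  have "\<not> int p dvd (2 * int k + 1) * (2 * int k + 1)"
    using k p_eq by (intro not_dvd_mult int_not_dvd) auto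
  from R_divide_int[OF x this] show ?thesis by (simp add: power2_eq_square)
qed

text \<open>The quantity is divisible by \<open>p^4\<close> and the ratio is 1 modulo
  \<open>p\<close>, so each step changes it by a multiple of \<open>p^5\<close>.\<close>

lemma quintic_part_cong: "k < m \<Longrightarrow> quintic_part k * (2 * of_nat k + 1)^2 - quintic_part 0 \<in> P 5"
proof (induction k)
  case 0 then show ?case by simp
next
  case (Suc k)
  define A where "A = quintic_part k * (2 * of_nat k + 1)^2"
  have A: "A - quintic_part 0 \<in> P 5" using Suc by (simp add: A_def)
  then have "A \<in> P 4" using P_add[OF P_mono[of "A - quintic_part 0" 5 4] quintic_part_0_P] by simp
  then have "A * (quintic_part_ratio k - 1) \<in> P (4 + 1)" using Suc by (intro P_mult quintic_part_ratio_cong)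
  then have "A * (quintic_part_ratio k - 1) + (A - quintic_part 0) \<in> P 5" using A by (intro P_add) auto
  moreover have "quintic_part (Suc k) * (2 * of_nat (Suc k) + 1)^2 = A * quintic_part_ratio k"
    using quintic_part_Suc[of k] Suc.prems by (simp add: A_def add_ac)
  ultimately show ?case by (simp add: algebra_simps)
qed

lemma sum_quintic_part_cong:
  "(\<Sum>k<m. quintic_part k) - quintic_part 0 * (\<Sum>k<m. 1 / (2 * of_nat k + 1)^2) \<in> P 5"
proof -
  have "quintic_part k - quintic_part 0 * (1 / (2 * of_nat k + 1)^2) \<in> P 5" if "k < m" for k
  proof -
    define o2 :: rat where "o2 = (2 * of_nat k + 1)^2"
    have "(2 * of_nat k + 1 :: rat) > 0" by (simp add: add_nonneg_pos)
    then have "o2 \<noteq> 0" by (simp add: o2_def)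
    then have "quintic_part k - quintic_part 0 * (1 / o2) = (quintic_part k * o2 - quintic_part 0) * (1 / o2)"
      by (simp add: field_simps)
    also have "\<dots> \<in> P 5"
      using quintic_part_cong[OF that] odd_square_inverse_R[OF that R_1] unfolding o2_def by (rule P_mult_R)
    finally show ?thesis by (simp add: o2_def)
  qed
  then have "(\<Sum>k<m. quintic_part k - quintic_part 0 * (1 / (2 * of_nat k + 1)^2)) \<in> P 5" by (intro P_sum) auto
  then show ?thesis by (simp add: sum_subtractf sum_distrib_left)
qed

end

section \<open>Harmonic sums and the supercongruences\<close>

text \<open>Splitting by parity and splitting into halves, the upper one reflected, are compared in
  \<open>harmonic_squares\<close>.\<close>

lemma sum_lessThan_double:
  fixes f :: "nat \<Rightarrow> rat"
  shows "(\<Sum>i<2*n. f i) = (\<Sum>i<n. f (2*i)) + (\<Sum>i<n. f (2*i+1))"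
    and "(\<Sum>i<2*n. f i) = (\<Sum>i<n. f i) + (\<Sum>i<n. f (2*n-1-i))"
proof -
  show "(\<Sum>i<2*n. f i) = (\<Sum>i<n. f (2*i)) + (\<Sum>i<n. f (2*i+1))"
    by (induction n) simp_all
  have "(\<Sum>i<2*n. f i) = (\<Sum>i<n. f i) + (\<Sum>i=n..<2*n. f i)"
    unfolding lessThan_atLeast0 by (rule sum.atLeastLessThan_concat[symmetric]) auto
  also have "(\<Sum>i=n..<2*n. f i) = (\<Sum>i<n. f (2*n-1-i))"
    by (rule sum.reindex_bij_witness[of _ "\<lambda>i. 2*n-1-i" "\<lambda>i. 2*n-1-i"]) auto
  finally show "(\<Sum>i<2*n. f i) = (\<Sum>i<n. f i) + (\<Sum>i<n. f (2*n-1-i))" .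
qed

section \<open>Sums of inverse squares and the last quintic summand\<close>

context odd_prime_localization
begin

lemma inverse_square_reflect:
  assumes "0 < a" "a < int p"
  shows "1 / (of_nat p - of_int a)^2 - 1 / (of_int a)^2 \<in> P 1"
proof -
  define b where "b = (int p - a)^2 * a^2"
  have b: "\<not> int p dvd b"
    unfolding b_def power2_eq_square using assms by (intro not_dvd_mult int_not_dvd) auto
  have nz: "(of_nat p - of_int a :: rat) \<noteq> 0" "(of_int a :: rat) \<noteq> 0"
  proof -
    have "(of_nat p - of_int a :: rat) = of_int (int p - a)" by simp
    then show "(of_nat p - of_int a :: rat) \<noteq> 0" using assms by (simp only: of_int_eq_0_iff)
  qed (use assms in auto)
  have "1 / (of_nat p - of_int a)^2 - 1 / (of_int a)^2
     = ((of_int a)^2 - (of_nat p - of_int a)^2) / ((of_nat p - of_int a)^2 * (of_int a :: rat)^2)"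
    using nz by (subst diff_frac_eq) auto
  also have "(of_int a)^2 - (of_nat p - of_int a)^2 = of_nat p * (of_int (2 * a - int p) :: rat)"
    by (simp add: power2_eq_square algebra_simps)
  also have "(of_nat p - of_int a)^2 * (of_int a)^2 = (of_int b :: rat)"
    by (simp add: b_def)
  also have "of_nat p * of_int (2 * a - int p) / of_int b = of_nat p * (of_int (2 * a - int p) / of_int b :: rat)"
    by simp
  also have "\<dots> \<in> P 1" by (intro P_1I R_divide_int b R_of_int)
  finally show ?thesis .
qed

text \<open>Let \<open>J\<close> and \<open>B\<close> be the two sums. Splitting the sum of inverse
  squares below \<open>p\<close> by parity and by reflection gives \<open>B + J/4 = 2*J\<close>
  modulo \<open>p\<close>; reflecting odd numbers to even ones gives \<open>B = J/4\<close>. Hence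
  \<open>3*J/2\<close> is 0 modulo \<open>p\<close>, and 3 is invertible for
  \<open>p > 3\<close>.\<close>

lemma harmonic_squares:
  assumes "p > 3"
  shows "(\<Sum>i<m. 1 / (of_nat i + 1)^2) \<in> P 1" "(\<Sum>i<m. 1 / (2 * of_nat i + 1)^2) \<in> P 1"
proof -
  define J where "J = (\<Sum>i<m. 1 / (of_nat i + 1 :: rat)^2)"
  define B where "B = (\<Sum>i<m. 1 / (2 * of_nat i + 1 :: rat)^2)"
  define f where "f = (\<lambda>i. 1 / (of_nat i + 1 :: rat)^2)"
  have b: "(\<Sum>i<m. f (2*i)) = B" by (simp add: f_def B_def)
  have j4: "(\<Sum>i<m. f (2*i+1)) = J / 4"
    unfolding f_def J_def sum_divide_distrib
  proof (intro sum.cong refl)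
    fix i
    have "(of_nat (2*i+1) + 1 :: rat)^2 = (of_nat i + 1)^2 * 4" by (simp add: power2_eq_square algebra_simps)
    then show "1 / (of_nat (2*i+1) + 1 :: rat)^2 = 1 / (of_nat i + 1)^2 / 4"
      by (simp only: divide_divide_eq_left)
  qed
  have j: "(\<Sum>i<m. f i) = J" by (simp add: f_def J_def)
  have r: "(\<Sum>i<m. f (2*m-1-i)) - J \<in> P 1"
    unfolding J_def sum_subtractf[symmetric]
  proof (rule P_sum)
    fix i assume i: "i \<in> {..<m}"
    then have "of_nat (2*m-1-i) + 1 = (of_nat p - of_int (int i + 1) :: rat)"
      by (simp add: p_eq of_nat_diff)
    then show "f (2*m-1-i) - 1 / (of_nat i + 1)^2 \<in> P 1"
      using inverse_square_reflect[of "int i + 1"] i p_eq by (simp add: f_def)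
  qed
  have "B + J / 4 - 2 * J = (\<Sum>i<m. f (2*m-1-i)) - J"
    using sum_lessThan_double[of f m] unfolding b j4 j by linarith
  then have 1: "B + J / 4 - 2 * J \<in> P 1" using r by (simp only:)
  \<comment> \<open>In reversed order the odd numbers are \<open>p - 2 * (i + 1)\<close>.\<close>
  have "B = (\<Sum>i<m. 1 / (2 * of_nat (m - Suc i) + 1)^2)"
    unfolding B_def by (rule sum.nat_diff_reindex[symmetric])
  moreover have "(\<Sum>i<m. 1 / (2 * of_nat (m - Suc i) + 1)^2) - J / 4 \<in> P 1"
    unfolding J_def sum_divide_distrib sum_subtractf[symmetric]
  proof (rule P_sum)
    fix i assume i: "i \<in> {..<m}"
    then have "2 * of_nat (m - Suc i) + 1 = (of_nat p - of_int (2 * (int i + 1)) :: rat)"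
      by (simp add: p_eq of_nat_diff)
    moreover have "1 / (of_int (2 * (int i + 1)))^2 = 1 / (of_nat i + 1 :: rat)^2 / 4"
    proof -
      have "(of_int (2 * (int i + 1)))^2 = (of_nat i + 1 :: rat)^2 * 4"
        by (simp add: power2_eq_square algebra_simps)
      then show ?thesis by (simp only: divide_divide_eq_left)
    qed
    ultimately show "1 / (2 * of_nat (m - Suc i) + 1)^2 - 1 / (of_nat i + 1)^2 / 4 \<in> P 1"
      using inverse_square_reflect[of "2 * (int i + 1)"] i p_eq by simp
  qed
  ultimately have 2: "B - J / 4 \<in> P 1" by simp
  have "3 * J / 2 \<in> P 1" using P_diff[OF 2 1] by (simp add: algebra_simps)
  moreover have "2 / of_int 3 \<in> R" using assms by (intro R_divide_int int_not_dvd) auto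
  ultimately have "3 * J / 2 * (2 / of_int 3) \<in> P 1" by (rule P_mult_R)
  then have J: "J \<in> P 1" by simp
  then show "(\<Sum>i<m. 1 / (of_nat i + 1)^2) \<in> P 1" by (simp add: J_def)
  have "J / 4 \<in> P 1" using P_mult_R[OF J R_half(2)[OF R_1]] by simp
  from P_add[OF 2 this] have "B \<in> P 1" by simp
  then show "(\<Sum>i<m. 1 / (2 * of_nat i + 1)^2) \<in> P 1" by (simp add: B_def)
qed

text \<open>The prefactor \<open>p^2\<close> leaves the rest to be known modulo \<open>p^3\<close>.
  Both \<open>lagrange_weight m m\<close> and \<open>u\<close> are products of factors
  \<open>1 + p^2 * x\<close>, and the sums of their \<open>x\<close> are divisible by
  \<open>p\<close> by \<open>harmonic_squares\<close>.\<close>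

lemma quintic_part_last_cong:
  assumes "p > 3" shows "quintic_part m - of_nat p ^ 2 * (fact m)^4 \<in> P 5"
proof -
  \<comment> \<open>\<open>(fact m)^2 * u\<close> will be a square root of
    \<open>cross_sq m (node m) 0\<close>.\<close>
  define u where "u = (\<Prod>i<m. 1 + of_nat p ^ 2 * (- (1 / 4 / (of_nat i + 1)^2)) :: rat)"
  have inv: "1 / (of_nat i + 1)^2 \<in> R" if "i < m" for i
    using R_divide_int[OF R_1, of "(int i + 1) * (int i + 1)"] that p_eq not_dvd_mult[of "int i + 1" "int i + 1"]
      int_not_dvd[of "int i + 1"] by (simp add: power2_eq_square)
  have u: "u - 1 \<in> P 3"
  proof -
    define s :: rat where "s = (\<Sum>i<m. - (1 / 4 / (of_nat i + 1)^2))"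
    have "s = (\<Sum>i<m. 1 / (of_nat i + 1)^2) * (- (1 / 4))"
      by (simp add: s_def sum_distrib_right sum_divide_distrib sum_negf mult.commute)
    moreover have "\<dots> \<in> P 1" by (intro P_mult_R harmonic_squares assms R_uminus R_half R_1)
    ultimately have "of_nat p ^ 2 * s \<in> P (2 + 1)"
      using P_mult[of "of_nat p ^ 2" 2 s 1] PI[of 1 2] by simp
    moreover have "u - 1 - of_nat p ^ 2 * s \<in> P 3"
      unfolding u_def s_def
    proof (rule P_prod_one_plus)
      fix i assume "i \<in> {..<m}"
      then show "- (1 / 4 / (of_nat i + 1)^2) \<in> R"
        using R_uminus[OF R_half(2)[OF inv[of i]]] by (simp add: mult.commute)
    qed
    ultimately show ?thesis using P_add[of "u - 1 - of_nat p ^ 2 * s" 3 "of_nat p ^ 2 * s"]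
      by (simp add: numeral_3_eq_3)
  qed
  have l: "lagrange_weight m m - 1 \<in> P 3"
  proof -
    define s where "s = (\<Sum>i<m. 1 / 4 / (node i - node m))"
    \<comment> \<open>Since \<open>4 * (node i - node m)\<close> is \<open>(2*i+1)^2 - p^2\<close>,
      the sums agree modulo \<open>p\<close> term by term.\<close>
    have "s - (\<Sum>i<m. 1 / (2 * of_nat i + 1)^2) \<in> P 1"
      unfolding s_def sum_subtractf[symmetric]
    proof (rule P_sum)
      fix i assume "i \<in> {..<m}"
      then have i: "i < m" by simp
      define o2 :: rat where "o2 = (2 * of_nat i + 1)^2"
      have "(2 * of_nat i + 1 :: rat) > 0" by (simp add: add_nonneg_pos)
      then have o2: "o2 \<noteq> 0" by (simp add: o2_def)
      define d where "d = node i - node m"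
      have d: "d \<noteq> 0" using i node_inj[of i m] by (simp add: d_def)
      have e: "o2 = 4 * d + of_nat p ^ 2" unfolding d_def node_last
        by (simp add: node_def o2_def power2_eq_square algebra_simps)
      have "1 / 4 / d - 1 / o2 = of_nat p * (of_nat p * (1 / 4 / d) * (1 / o2))"
        using d o2 by (simp add: field_simps) (simp add: e power2_eq_square algebra_simps)
      also have "\<dots> \<in> P 1"
        using last_ratio_R[OF i] odd_square_inverse_R[OF i R_1]
        unfolding d_def o2_def by (intro P_1I R_mult R_of_nat)
      finally show "1 / 4 / (node i - node m) - 1 / (2 * of_nat i + 1)^2 \<in> P 1"
        by (simp only: d_def o2_def)
    qed
    from P_add[OF this harmonic_squares(2)[OF assms]] have "s \<in> P 1" by simp
    then have "of_nat p ^ 2 * s \<in> P (2 + 1)"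
      using P_mult[of "of_nat p ^ 2" 2 s 1] PI[of 1 2] by simp
    moreover have "lagrange_weight m m - 1 - of_nat p ^ 2 * s \<in> P 3"
      unfolding lagrange_weight_last s_def by (rule P_prod_one_plus, rule last_ratio_R) simp
    ultimately show ?thesis using P_add[of "lagrange_weight m m - 1 - of_nat p ^ 2 * s" 3 "of_nat p ^ 2 * s"]
      by (simp add: numeral_3_eq_3)
  qed
  have "cross_sq m (node m) 0 = ((fact m)^2 * u)^2"
  proof -
    have "cross_sq m (node m) 0 = (\<Prod>i<m. (of_nat i + 1)^2 - node m)^2"
      by (simp add: cross_sq_def prod_power_distrib)
    also have "(\<Prod>i<m. (of_nat i + 1)^2 - node m)
       = (\<Prod>i<m. (of_nat i + 1)^2 * (1 + of_nat p ^ 2 * (- (1 / 4 / (of_nat i + 1)^2))))"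
    proof (intro prod.cong refl)
      fix i
      define o1 :: rat where "o1 = of_nat i + 1"
      have "o1 > 0" by (simp add: o1_def add_nonneg_pos)
      then show "(of_nat i + 1)^2 - node m = (of_nat i + 1)^2 * (1 + of_nat p ^ 2 * (- (1 / 4 / (of_nat i + 1)^2)))"
        unfolding node_last o1_def[symmetric] by (simp add: field_simps)
    qed
    also have "\<dots> = (fact m)^2 * u" by (simp only: prod.distrib prod_squares u_def)
    finally show ?thesis .
  qed
  then have "quintic_part m = of_nat p ^ 2 * (lagrange_weight m m * (fact m)^4 * u^2)"
    unfolding quintic_part_def node_last by (simp add: power_mult_distrib)
  then have "quintic_part m - of_nat p ^ 2 * (fact m)^4
    = of_nat p ^ 2 * ((lagrange_weight m m - 1) * ((fact m)^4 * u^2) + (fact m)^4 * ((u - 1) * (u + 1)))"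
    by (simp add: algebra_simps power2_eq_square)
  also have "\<dots> \<in> P (2 + 3)"
  proof -
    have uR: "u \<in> R" using R_add[OF P_R[OF u] R_1] by simp
    have f: "fact m \<in> R" using R_of_nat[of "fact m"] by simp
    have p2: "of_nat p ^ 2 \<in> P 2" using PI[of 1 2] by simp
    show ?thesis
      by (intro P_mult p2 P_add P_mult_R P_mult_R' l u R_mult R_power R_add R_1 uR f)
  qed
  finally show ?thesis by simp
qed

text \<open>Modulo \<open>p^5\<close> the summands before the last add up to
  \<open>quintic_part 0\<close>, divisible by \<open>p^4\<close>, times a harmonic sum divisible by
  \<open>p\<close>.\<close>

lemma quintic_num_zero_cong:
  assumes "p > 3" shows "quintic_num m 0 0 - of_nat p ^ 2 * (fact m)^4 \<in> P 5"
proof -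
  have "quintic_num m 0 0 = (\<Sum>k<m. quintic_part k) + quintic_part m"
    unfolding quintic_num_zero quintic_part_def by (simp flip: lessThan_Suc_atMost)
  moreover have "(\<Sum>k<m. quintic_part k) \<in> P 5"
  proof -
    have "quintic_part 0 * (\<Sum>k<m. 1 / (2 * of_nat k + 1)^2) \<in> P (4 + 1)"
      by (intro P_mult quintic_part_0_P harmonic_squares assms)
    then have "quintic_part 0 * (\<Sum>k<m. 1 / (2 * of_nat k + 1)^2) \<in> P 5" by simp
    from P_add[OF sum_quintic_part_cong this] show ?thesis by simp
  qed
  ultimately show ?thesis using P_add[OF _ quintic_part_last_cong[OF assms]] by (metis add_diff_eq)
qed

text \<open>The factor \<open>1/2 + m = p/2\<close> enters the Pochhammer symbol as soon as
  \<open>n > m\<close>.\<close>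

lemma half_coeff_P: assumes "m < n" "n < p" shows "half_coeff n \<in> P 1"
proof -
  have "pochhammer (1/2) n \<in> P 1"
    unfolding pochhammer_prod
  proof (rule P_prod_member[where i = m])
    have "1/2 + of_nat m = of_nat p * (1 / 2 :: rat)" by (simp add: p_eq field_simps)
    also have "\<dots> \<in> P 1" by (intro P_1I R_half R_1)
    finally show "1/2 + of_nat m \<in> P 1" .
  qed (use assms in \<open>auto intro!: R_add R_half\<close>)
  moreover have "1 / fact n \<in> R" using assms by (intro R_divide_fact R_1)
  ultimately have "pochhammer (1/2) n * (1 / fact n) \<in> P 1" by (rule P_mult_R)
  then show ?thesis by (simp add: half_coeff_def)
qed

lemma rat_congI:
  assumes "x - y \<in> P k" "y \<in> R" shows "rat_cong p x y (p ^ k)"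
proof -
  have "x \<in> R" using R_add[OF P_R[OF assms(1)] assms(2)] by simp
  then show ?thesis using assms unfolding rat_cong_def by (auto simp: P_def)
qed

end

section \<open>Return to the original sums\<close>

lemma half_sq_zero: "half_sq n 0 = (pochhammer (1/2) n)^2"
  by (simp add: half_sq_def pochhammer_prod lessThan_atLeast0 prod_power_distrib add.commute)

lemma fact_split: "n \<le> m \<Longrightarrow> (fact m :: rat) = fact n * (\<Prod>i=n..<m. of_nat i + 1)"
  by (induction m rule: dec_induct) (auto simp: algebra_simps)

text \<open>At \<open>Y = 0\<close> the completing product is \<open>(fact m / fact n)^2\<close>,
  and \<open>half_sq n 0\<close> supplies the other two powers of the Pochhammer symbol.\<close>

lemma cubic_num_at_zero:
  "cubic_num z m 0 = (fact m)^2 * (\<Sum>n\<le>m. (half_coeff n)^3 * (3 * of_nat n + 1) * z^n)"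
  unfolding cubic_num_def sum_distrib_left
proof (intro sum.cong refl)
  fix n assume "n \<in> {..m}"
  then have "n \<le> m" by simp
  from fact_split[OF this] show "half_coeff n * z^n * (3 * of_nat n + 1) * half_sq n 0
      * (\<Prod>i=n..<m. (of_nat i + 1)^2 - 4 * 0)
    = (fact m)^2 * ((half_coeff n)^3 * (3 * of_nat n + 1) * z^n)"
    by (simp add: half_sq_zero half_coeff_def prod.distrib power_mult_distrib power_divide
        power2_eq_square power3_eq_cube)
qed

lemma quintic_num_at_zero:
  "quintic_num m 0 0 = (fact m)^4 * (\<Sum>n\<le>m. (half_coeff n)^5 * (10 * (of_nat n)^2 + 6 * of_nat n + 1) * (-4)^n)"
  unfolding quintic_num_def sum_distrib_left
proof (intro sum.cong refl)
  fix n assume "n \<in> {..m}"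
  then have "n \<le> m" by simp
  define r :: rat where "r = (\<Prod>i=n..<m. of_nat i + 1)"
  define q :: rat where "q = 10 * (of_nat n)^2 + 6 * of_nat n + 1"
  have pr: "(\<Prod>i=n..<m. ((of_nat i + 1)^2 - 0 - 0)^2 - 4 * 0 * 0) = r^4"
    by (simp add: r_def prod_power_distrib flip: power_mult)
  have f: "fact m = fact n * r" using fact_split[OF \<open>n \<le> m\<close>] by (simp add: r_def)
  define h where "h = half_coeff n"
  have hp: "pochhammer (1/2) n = h * fact n" by (simp add: h_def half_coeff_def)
  have "h * (-4)^n * q * (h * fact n)^2 * (h * fact n)^2 * r^4 = (fact n * r)^4 * (h^5 * q * (-4)^n)"
    by (simp add: power_mult_distrib eval_nat_numeral)
  then show "half_coeff n * (-4)^n * (10 * (of_nat n)^2 + 6 * of_nat n + 1 - 2 * 0 - 2 * 0)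
      * half_sq n 0 * half_sq n 0 * (\<Prod>i=n..<m. ((of_nat i + 1)^2 - 0 - 0)^2 - 4 * 0 * 0)
    = (fact m)^4 * ((half_coeff n)^5 * (10 * (of_nat n)^2 + 6 * of_nat n + 1) * (-4)^n)"
    unfolding pr f half_sq_zero hp h_def[symmetric] q_def by (simp only: mult_zero_right diff_zero)
qed

context odd_prime_localization
begin

text \<open>As \<open>m < p\<close>, \<open>fact m\<close> is a unit of \<open>R\<close>, so the
  congruence for the numerator can be divided by \<open>(fact m)^2\<close>.\<close>

lemma cubic_sum_cong:
  assumes v: "\<And>k. (\<Sum>n\<le>k. cubic_term z n (node k)) = e k * (2 * of_nat k + 1)" and e: "\<And>k. e k \<in> R"
  shows "(\<Sum>n\<le>m. (half_coeff n)^3 * (3 * of_nat n + 1) * z^n) - e m * of_nat p \<in> P 3"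
proof -
  define S where "S = (\<Sum>n\<le>m. (half_coeff n)^3 * (3 * of_nat n + 1) * z^n)"
  have "(cubic_num z m 0 - e m * of_nat p * (fact m)^2) * (1 / fact m / fact m) \<in> P 3"
    using p_eq by (intro P_mult_R cubic_num_zero_cong v e R_divide_fact R_1) auto
  moreover have "(cubic_num z m 0 - e m * of_nat p * (fact m)^2) * (1 / fact m / fact m) = S - e m * of_nat p"
    unfolding cubic_num_at_zero S_def[symmetric] by (simp add: field_simps power2_eq_square)
  ultimately show ?thesis by (simp add: S_def)
qed

lemma quintic_sum_cong:
  assumes "p > 3"
  shows "(\<Sum>n\<le>m. (half_coeff n)^5 * (10 * (of_nat n)^2 + 6 * of_nat n + 1) * (-4)^n) - of_nat p ^ 2 \<in> P 5"
proof -
  define S where "S = (\<Sum>n\<le>m. (half_coeff n)^5 * (10 * (of_nat n)^2 + 6 * of_nat n + 1) * (-4)^n)"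
  have "(quintic_num m 0 0 - of_nat p ^ 2 * (fact m)^4) * (1 / fact m / fact m / fact m / fact m) \<in> P 5"
    using p_eq by (intro P_mult_R quintic_num_zero_cong assms R_divide_fact R_1) auto
  moreover have "(quintic_num m 0 0 - of_nat p ^ 2 * (fact m)^4) * (1 / fact m / fact m / fact m / fact m)
      = S - of_nat p ^ 2"
    unfolding quintic_num_at_zero S_def[symmetric] by (simp add: field_simps eval_nat_numeral)
  ultimately show ?thesis by (simp add: S_def)
qed

end

theorem mainTheorem1:
  fixes p :: nat
  assumes "prime p"
  shows "(p > 2 \<longrightarrow>
           rat_cong p
             (\<Sum>n=0..(p - 1) div 2.
                (pochhammer (1/2) n) ^ 3 / (fact n) ^ 3 * (3 * of_nat n + 1) * 2 ^ (2 * n))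
             (of_nat p) (p ^ 3)) \<and>
         (p > 3 \<longrightarrow>
           rat_cong p
             (\<Sum>n=0..(p - 1) div 2.
                (pochhammer (1/2) n) ^ 5 / (fact n) ^ 5
                  * (10 * (of_nat n) ^ 2 + 6 * of_nat n + 1) * (-1) ^ n * 2 ^ (2 * n))
             ((of_nat p) ^ 2) (p ^ 5)) \<and>
         (p > 2 \<longrightarrow>
           rat_cong p
             (\<Sum>n=0..p - 1.
                (pochhammer (1/2) n) ^ 3 / (pochhammer 1 n) ^ 3
                  * (3 * of_nat n + 1) * (-1) ^ n * 2 ^ (3 * n))
             ((-1) ^ ((p - 1) div 2) * of_nat p) (p ^ 3))"
proof (cases "p > 2")
  case False
  then show ?thesis by simp
next
  case True
  define m where "m = (p - 1) div 2"
  have "odd p" using assms True prime_odd_nat by blast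
  then have "p = 2 * m + 1" unfolding m_def by presburger
  then interpret odd_prime_localization p m
    using assms True by unfold_locales auto
  have pow: "(-1 :: rat)^n * 2 ^ (2 * n) = (-4)^n" "(-1 :: rat)^n * 2 ^ (3 * n) = (-8)^n" for n
    by (simp_all add: power_mult flip: power_mult_distrib)
  have "(\<Sum>n=0..m. (pochhammer (1/2) n) ^ 3 / (fact n) ^ 3 * (3 * of_nat n + 1) * 2 ^ (2 * n))
      = (\<Sum>n\<le>m. (half_coeff n)^3 * (3 * of_nat n + 1) * 4^n)"
    by (simp add: half_coeff_def power_divide power_mult atMost_atLeast0)
  then have 1: "rat_cong p
      (\<Sum>n=0..m. (pochhammer (1/2) n) ^ 3 / (fact n) ^ 3 * (3 * of_nat n + 1) * 2 ^ (2 * n))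
      (of_nat p) (p ^ 3)"
    using cubic_sum_cong[of 4 "\<lambda>_. 1"] cubic_sum_4 by (intro rat_congI) auto
  have "(\<Sum>n=0..m. (pochhammer (1/2) n) ^ 5 / (fact n) ^ 5
          * (10 * (of_nat n) ^ 2 + 6 * of_nat n + 1) * (-1) ^ n * 2 ^ (2 * n))
      = (\<Sum>n\<le>m. (half_coeff n)^5 * (10 * (of_nat n)^2 + 6 * of_nat n + 1) * (-4)^n)"
    by (simp only: half_coeff_def power_divide mult.assoc pow atMost_atLeast0)
  then have 2: "rat_cong p
      (\<Sum>n=0..m. (pochhammer (1/2) n) ^ 5 / (fact n) ^ 5
          * (10 * (of_nat n) ^ 2 + 6 * of_nat n + 1) * (-1) ^ n * 2 ^ (2 * n))
      ((of_nat p)^2) (p ^ 5)" if "p > 3"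
    using quintic_sum_cong[OF that] by (intro rat_congI) (auto intro: R_power)
  have 3: "rat_cong p
      (\<Sum>n=0..p - 1. (pochhammer (1/2) n) ^ 3 / (pochhammer 1 n) ^ 3
          * (3 * of_nat n + 1) * (-1) ^ n * 2 ^ (3 * n))
      ((-1)^m * of_nat p) (p ^ 3)"
  proof (rule rat_congI)
    have e: "(-1)^k \<in> R" for k by (intro R_power R_uminus R_1)
    define g where "g = (\<lambda>n. (half_coeff n)^3 * (3 * of_nat n + 1) * (-8)^n)"
    have "(\<Sum>n=0..p - 1. (pochhammer (1/2) n) ^ 3 / (pochhammer 1 n) ^ 3
          * (3 * of_nat n + 1) * (-1) ^ n * 2 ^ (3 * n)) = (\<Sum>n\<le>p - 1. g n)"
      by (simp only: g_def half_coeff_def power_divide mult.assoc pow atMost_atLeast0 pochhammer_fact)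
    \<comment> \<open>Beyond \<open>m\<close> the coefficient \<open>half_coeff n\<close> is
      divisible by \<open>p\<close> and its cube by \<open>p^3\<close>, so the tail does not affect
      the congruence.\<close>
    also have "{..p - 1} = {..m} \<union> {m<..p - 1}" using p_eq by auto
    also have "sum g \<dots> = (\<Sum>n\<le>m. g n) + sum g {m<..p - 1}"
      by (intro sum.union_disjoint) auto
    finally have s: "(\<Sum>n=0..p - 1. (pochhammer (1/2) n) ^ 3 / (pochhammer 1 n) ^ 3
          * (3 * of_nat n + 1) * (-1) ^ n * 2 ^ (3 * n)) - (-1)^m * of_nat p
        = ((\<Sum>n\<le>m. g n) - (-1)^m * of_nat p) + sum g {m<..p - 1}" by simp
    have "sum g {m<..p - 1} \<in> P 3"
    proof (rule P_sum)
      fix n assume "n \<in> {m<..p - 1}"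
      then have h: "half_coeff n \<in> P 1" using p_eq by (intro half_coeff_P) auto
      have "half_coeff n * half_coeff n * half_coeff n * (3 * of_nat n + 1) * (-8)^n \<in> P (1 + 1 + 1)"
        by (intro P_mult_R P_mult h R_add R_mult R_power R_uminus R_numeral R_of_nat R_1)
      then show "g n \<in> P 3" by (simp add: g_def power3_eq_cube numeral_3_eq_3 mult.assoc)
    qed
    then show "(\<Sum>n=0..p - 1. (pochhammer (1/2) n) ^ 3 / (pochhammer 1 n) ^ 3
          * (3 * of_nat n + 1) * (-1) ^ n * 2 ^ (3 * n)) - (-1)^m * of_nat p \<in> P 3"
      unfolding s using cubic_sum_cong[OF cubic_sum_8 e] unfolding g_def by (intro P_add)
    show "(-1)^m * of_nat p \<in> R" by (intro R_mult e R_of_nat)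
  qed
  show ?thesis using 1 2 3 unfolding m_def by blast
qed

end
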